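(* There exists a probability measure $\sigma$ on $\mathbb{T}$ with infinite support belonging to the Szeg\H{o} class such that the limit $\lim_{n\to\infty}\phi_n^*(z,\sigma)$ does not exist for any $z\in\mathbb{T}$.
   Context: $\mathbb{T}$ is the unit circle and $m$ the normalized Lebesgue (probability) measure on $\mathbb{T}$. For a probability measure $\sigma$ on $\mathbb{T}$ with infinite support, $\phi_n(z,\sigma)$ denotes the orthonormal polynomials: $\deg\phi_n=n$, the leading coefficient of $\phi_n$ is positive, $\int_{\mathbb{T}}\phi_n\overline{\phi_k}\,d\sigma=\delta_{nk}$. For a polynomial $Q$ of degree $n$, $Q^*(z):=z^n\overline{Q(\bar z^{-1})}$. The measure $\sigma$ is in the Szeg\H{o} class if, writing $d\sigma=w\,dm+d\sigma_s$ with $\sigma_s$ singular, $\int_{\mathbb{T}}\log w\,dm>-\infty$. *)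

theory Defs
  imports "HOL-Probability.Probability" "HOL-Computational_Algebra.Polynomial"
begin

abbreviation circle :: "complex set" where
  "circle \<equiv> sphere 0 1"

definition circle_m :: "complex measure" where
  "circle_m = distr (uniform_measure lborel {0..2*pi}) borel cis"

definition prob_on_circle :: "complex measure \<Rightarrow> bool" where
  "prob_on_circle \<sigma> \<longleftrightarrow> sets \<sigma> = sets borel \<and> prob_space \<sigma> \<and>
     emeasure \<sigma> (UNIV - circle) = 0"

definition msupport :: "complex measure \<Rightarrow> complex set" where
  "msupport \<sigma> = {z. \<forall>e>0. emeasure \<sigma> (ball z e) > 0}"

definition pstar :: "complex poly \<Rightarrow> complex \<Rightarrow> complex" where
  "pstar Q z = z ^ degree Q * cnj (poly Q (inverse (cnj z)))"

definition is_ONP :: "complex measure \<Rightarrow> (nat \<Rightarrow> complex poly) \<Rightarrow> bool" where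
  "is_ONP \<sigma> \<phi> \<longleftrightarrow>
     (\<forall>n. degree (\<phi> n) = n \<and> lead_coeff (\<phi> n) \<in> \<real> \<and> Re (lead_coeff (\<phi> n)) > 0) \<and>
     (\<forall>n k. (\<integral>z. poly (\<phi> n) z * cnj (poly (\<phi> k) z) \<partial>\<sigma>) = (if n = k then 1 else 0))"

definition ONP :: "complex measure \<Rightarrow> nat \<Rightarrow> complex poly" where
  "ONP \<sigma> = (THE \<phi>. is_ONP \<sigma> \<phi>)"

definition szego_class :: "complex measure \<Rightarrow> bool" where
  "szego_class \<sigma> \<longleftrightarrow>
     (\<exists>w \<sigma>s. w \<in> borel_measurable borel \<and> (\<forall>z. w z \<ge> 0) \<and>
        sets \<sigma>s = sets borel \<and>
        (\<exists>N \<in> sets borel. emeasure circle_m N = 0 \<and> emeasure \<sigma>s (UNIV - N) = 0) \<and>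
        (\<forall>A \<in> sets borel. emeasure \<sigma> A =
            (\<integral>\<^sup>+ z. ennreal (w z) * indicator A z \<partial>circle_m) + emeasure \<sigma>s A) \<and>
        (AE z in circle_m. w z > 0) \<and>
        (\<integral>\<^sup>+ z. ennreal (- ln (w z)) \<partial>circle_m) < \<infinity>)"

end

theory Submission
  imports Defs "HOL-Complex_Analysis.Complex_Analysis"
begin

text \<open>
  The measure is built from its recurrence coefficients \<open>\<alpha>\<^sub>n\<close>. On the circle the reversed monic polynomials
  satisfy \<open>u\<^sub>n\<^sub>+\<^sub>1 = u\<^sub>n - \<alpha>\<^sub>n z\<^sup>n\<^sup>+\<^sup>1 \<cdot> cnj u\<^sub>n\<close>. To second order, a coefficient of size \<open>\<delta>\<close> oscillating at angular
  distance \<open>\<psi>\<close> from \<open>z\<close> rotates the phase of \<open>u\<close> by about \<open>\<delta>\<^sup>2/\<psi>\<close> per step and hardly changes its modulus.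
  A chirp of length \<open>2L\<close> with \<open>\<delta>\<^sup>2 L = \<epsilon>\<^sup>2\<close> sweeps all frequencies, so for every \<open>z\<close> the phase moves by about
  \<open>\<epsilon>\<^sup>2 ln L\<close> just after the resonance at \<open>z\<close>, while the modulus changes only by a factor \<open>1 + O(\<epsilon>)\<close>. Take
  \<open>\<epsilon> = 2\<^sup>-\<^sup>k\<close> up to a constant, with \<open>L\<close> exponentially large in \<open>1/\<epsilon>\<^sup>2\<close>, and concatenate these chirps: the moduli
  converge to a limit bounded above and below, so by the Bernstein-Szego formula the orthogonality measure has a
  density bounded away from \<open>0\<close>, but the phase turns by a fixed angle in every chirp.
\<close>

section \<open>Lorentzian sums over roots of unity\<close>

lemma sum_root_of_unity_powers:
  fixes L k :: nat
  assumes "0 < k" "k < L"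
  shows "(\<Sum>n<L. cis (2 * pi * real n / real L) ^ k) = 0"
proof -
  define q where "q = cis (2 * pi * real k / real L)"
  have pw: "cis (2 * pi * real n / real L) ^ k = q ^ n" for n
    unfolding q_def Complex.DeMoivre by (rule arg_cong[where f = cis]) simp
  have "q ^ L = 1"
    using assms cis_multiple_2pi[of "real k"] unfolding q_def Complex.DeMoivre by simp
  moreover have "q \<noteq> 1"
  proof
    assume "q = 1"
    then have "cos (2 * pi * real k / real L) = 1"
      by (simp add: q_def complex_eq_iff)
    then obtain j :: int where "2 * pi * real k / real L = j * 2 * pi"
      using cos_one_2pi_int by auto
    then have "real k = of_int j * real L"
      using assms by (simp add: field_simps)
    then have jk: "int k = j * int L"
      by (metis of_int_eq_iff of_int_mult of_int_of_nat_eq)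
    have "j > 0"
      by (rule ccontr) (use jk assms mult_nonpos_nonneg[of j "int L"] in auto)
    then have "int L \<le> j * int L" by (simp add: mult_le_cancel_right1)
    with jk assms show False by linarith
  qed
  ultimately show ?thesis by (simp add: pw sum_gp_strict)
qed

text \<open>Every L-th root of unity c satisfies (w c)^L = w^L, so each summand is a finite
  geometric sum in w c over the common denominator 1 - w^L. Summing over the roots leaves only the
  power 0.\<close>

lemma sum_inverse_over_roots:
  fixes L :: nat and w :: complex
  assumes "0 < L" "norm w < 1"
  shows "(\<Sum>n<L. 1 / (1 - w * cis (2 * pi * real n / real L))) = of_nat L / (1 - w ^ L)"
proof -
  let ?c = "\<lambda>n. cis (2 * pi * real n / real L)"
  have wL: "w ^ L \<noteq> 1"
    using assms by (metis norm_one norm_power power_less_one_iff norm_ge_zero less_irrefl)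
  have "1 / (1 - w * ?c n) = (\<Sum>k<L. w ^ k * ?c n ^ k) / (1 - w ^ L)" for n
  proof -
    have n1: "w * ?c n \<noteq> 1"
      using assms by (metis norm_one norm_mult norm_cis mult.right_neutral less_irrefl)
    have cL: "?c n ^ L = 1"
      using assms cis_multiple_2pi[of "real n"] unfolding Complex.DeMoivre by simp
    have "(\<Sum>k<L. (w * ?c n) ^ k) = (1 - (w * ?c n) ^ L) / (1 - w * ?c n)"
      using n1 by (simp add: sum_gp_strict)
    also have "(w * ?c n) ^ L = w ^ L" by (simp only: power_mult_distrib cL mult_1_right)
    finally show ?thesis using wL by (simp add: power_mult_distrib)
  qed
  then have "(\<Sum>n<L. 1 / (1 - w * ?c n)) = (\<Sum>n<L. (\<Sum>k<L. w ^ k * ?c n ^ k)) / (1 - w ^ L)"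
    by (simp add: sum_divide_distrib)
  also have "(\<Sum>n<L. (\<Sum>k<L. w ^ k * ?c n ^ k)) = (\<Sum>k<L. w ^ k * (\<Sum>n<L. ?c n ^ k))"
    by (subst sum.swap) (simp add: sum_distrib_left)
  also have "\<dots> = (\<Sum>k<L. if k = 0 then of_nat L else 0)"
    by (rule sum.cong) (use sum_root_of_unity_powers in auto)
  also have "\<dots> = of_nat L" using assms by simp
  finally show ?thesis .
qed

text \<open>With r = 1 - 1/N the right-hand side is at most the Lorentzian denominator of width 1/N,
  which links Lorentzians to Poisson kernels.\<close>

lemma norm_one_minus_scaled:
  fixes z :: complex
  assumes "norm z = 1"
  shows "norm (1 - of_real r * z) ^ 2 = (1 - r)^2 + r * norm (1 - z) ^ 2"
proof -
  have "(Re z)\<^sup>2 + (Im z)\<^sup>2 = 1" using assms by (simp add: cmod_def)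
  then show ?thesis
    unfolding cmod_power2 by (simp add: power2_eq_square) algebra
qed

text \<open>The right-hand side is the Poisson kernel; in this form
  \<open>sum_inverse_over_roots\<close> sums it exactly.\<close>

lemma two_Re_inverse_one_minus:
  fixes w :: complex
  assumes "norm w < 1"
  shows "2 * Re (1 / (1 - w)) - 1 = (1 - norm w ^ 2) / norm (1 - w) ^ 2"
proof -
  have nz: "w \<noteq> 1" using assms by auto
  have p: "(1 - Re w)\<^sup>2 + (Im w)\<^sup>2 \<noteq> 0"
    using nz by (auto simp: complex_eq_iff sum_power2_eq_zero_iff)
  show ?thesis
    unfolding cmod_power2 using p
    by (simp add: Re_divide power2_eq_square field_simps)
qed

text \<open>For the radius 1 - 1/N and L = N^2 roots this keeps w^L away from 1, so the denominator
  in \<open>sum_inverse_over_roots\<close> has modulus at least 1/2.\<close>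

lemma one_minus_inverse_power_le_half:
  fixes N :: nat
  assumes "1 \<le> N"
  shows "(1 - 1 / real N) ^ (N\<^sup>2) \<le> 1/2"
proof -
  let ?r = "1 - 1 / real N"
  have r: "0 \<le> ?r" "?r \<le> 1" using assms by (auto simp: field_simps)
  have "?r ^ (N\<^sup>2) \<le> ?r ^ N" 
    by (rule power_decreasing) (use r assms in \<open>auto simp: power2_eq_square\<close>)
  also have "\<dots> \<le> exp (- 1 / real N) ^ N"
    using exp_ge_add_one_self[of "- 1 / real N"] r by (intro power_mono) auto
  also have "\<dots> = exp (- 1)" using assms by (simp flip: exp_of_nat_mult)
  also have "\<dots> \<le> 1/2"
    using exp_ge_add_one_self[of 1] by (simp add: exp_minus field_simps)
  finally show ?thesis .
qed

text \<open>With r = 1 - 1/N, each Lorentzian is at most the Poisson kernel of radius r divided by 1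
  - r^2. The kernels sum to at most 4 N^2 over the N^2 roots, and dividing by 1 - r^2, which is at
  least 1/N, costs one more factor N.\<close>

lemma sum_lorentzian_over_roots:
  fixes N :: nat and z :: complex
  assumes N: "1 \<le> N" and z: "norm z = 1"
  shows "(\<Sum>n<N\<^sup>2. 1 / (norm (1 - z * cis (2 * pi * real n / real (N\<^sup>2))) ^ 2 + (1 / real N) ^ 2)) \<le> 4 * real N ^ 3"
proof -
  define r where "r = 1 - 1 / real N"
  let ?L = "N\<^sup>2"
  let ?x = "\<lambda>n. z * cis (2 * pi * real n / real ?L)"
  have r: "0 \<le> r" "r < 1" using N by (auto simp: r_def field_simps)
  have nx: "norm (?x n) = 1" for n using z by (simp add: norm_mult)
  have nw: "norm (of_real r * z) < 1" using z r by (simp add: norm_mult)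
  have le: "1 / (norm (1 - ?x n) ^ 2 + (1 / real N) ^ 2) \<le> 1 / norm (1 - of_real r * ?x n) ^ 2" for n
  proof (rule divide_left_mono)
    have "of_real r * ?x n \<noteq> 1" using nx[of n] r 
      by (metis abs_of_nonneg mult.right_neutral norm_mult norm_of_real norm_one less_irrefl)
    then have "0 < norm (1 - of_real r * ?x n) ^ 2" by simp
    moreover have "norm (1 - of_real r * ?x n) ^ 2 \<le> norm (1 - ?x n) ^ 2 + (1 / real N) ^ 2"
      unfolding norm_one_minus_scaled[OF nx] 
      using r mult_left_le_one_le[of "norm (1 - ?x n) ^ 2" r] by (simp add: r_def)
    ultimately show "norm (1 - of_real r * ?x n) ^ 2 \<le> norm (1 - ?x n) ^ 2 + (1 / real N) ^ 2"
      "0 < (norm (1 - ?x n) ^ 2 + (1 / real N) ^ 2) * norm (1 - of_real r * ?x n) ^ 2"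
      by (blast intro: mult_pos_pos less_le_trans)+
  qed simp
  have P: "(1 - r^2) * (1 / norm (1 - of_real r * ?x n) ^ 2) = 2 * Re (1 / (1 - of_real r * z * cis (2 * pi * real n / real ?L))) - 1" for n
  proof -
    have nn: "norm (of_real r * ?x n) = r" using nx[of n] r by (simp add: norm_mult)
    show ?thesis
      using two_Re_inverse_one_minus[of "of_real r * ?x n"] r unfolding nn by (simp add: mult.assoc)
  qed
  have "(1 - r^2) * (\<Sum>n<?L. 1 / norm (1 - of_real r * ?x n) ^ 2)
      = 2 * Re (\<Sum>n<?L. 1 / (1 - of_real r * z * cis (2 * pi * real n / real ?L))) - real ?L"
    unfolding sum_distrib_left P by (simp add: sum_subtractf Re_sum sum_distrib_left)
  also have "\<dots> = 2 * Re (of_nat ?L / (1 - (of_real r * z) ^ ?L)) - real ?L"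
    by (subst sum_inverse_over_roots) (use N nw in auto)
  also have "\<dots> \<le> 2 * norm (of_nat ?L / (1 - (of_real r * z) ^ ?L))"
    using complex_Re_le_cmod[of "of_nat ?L / (1 - (of_real r * z) ^ ?L)"] by (simp del: of_nat_power)
  also have "\<dots> = 2 * real ?L / norm (1 - (of_real r * z) ^ ?L)" by (simp add: norm_divide norm_power)
  also have "\<dots> \<le> 2 * real ?L / (1/2)"
  proof (rule divide_left_mono)
    have "norm ((of_real r * z) ^ ?L) = r ^ ?L" using r z by (simp add: norm_power norm_mult)
    also have "\<dots> \<le> 1/2" unfolding r_def by (rule one_minus_inverse_power_le_half[OF N])
    finally show "1/2 \<le> norm (1 - (of_real r * z) ^ ?L)"
      using norm_triangle_ineq2[of 1 "(of_real r * z) ^ ?L"] by simp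
    then show "0 < norm (1 - (of_real r * z) ^ ?L) * (1/2)" by linarith
  qed simp
  finally have 1: "(1 - r^2) * (\<Sum>n<?L. 1 / norm (1 - of_real r * ?x n) ^ 2) \<le> 4 * real N ^ 2"
    by simp
  have "1 / real N \<le> 1 - r^2" using r N
    by (simp add: r_def power2_eq_square field_simps)
  then have "1 / real N * (\<Sum>n<?L. 1 / norm (1 - of_real r * ?x n) ^ 2)
       \<le> (1 - r^2) * (\<Sum>n<?L. 1 / norm (1 - of_real r * ?x n) ^ 2)"
    by (intro mult_right_mono sum_nonneg) auto
  with 1 have 2: "1 / real N * (\<Sum>n<?L. 1 / norm (1 - of_real r * ?x n) ^ 2) \<le> 4 * real N ^ 2" by linarith
  have "(\<Sum>n<?L. 1 / norm (1 - of_real r * ?x n) ^ 2) \<le> 4 * real N ^ 3"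
    using 2 N by (simp add: field_simps power3_eq_cube power2_eq_square)
  moreover have "(\<Sum>n<?L. 1 / (norm (1 - ?x n) ^ 2 + (1 / real N) ^ 2)) \<le> (\<Sum>n<?L. 1 / norm (1 - of_real r * ?x n) ^ 2)"
    by (intro sum_mono le)
  ultimately show ?thesis by linarith
qed

section \<open>The phase and modulus under one chirp\<close>

text \<open>Discrete Gronwall inequality. Bounding the displacement from \<open>x m\<close>, and not
  just the growth of the norm, lets it serve both for the unwound orbit inside one chirp and for the
  moduli across chirps.\<close>

lemma relative_gronwall:
  fixes x :: "nat \<Rightarrow> 'a::real_normed_vector" and \<kappa> :: "nat \<Rightarrow> real"
  assumes step: "\<And>n. n < M \<Longrightarrow> norm (x (Suc n) - x n) \<le> \<kappa> n * norm (x n)"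
    and nonneg: "\<And>n. 0 \<le> \<kappa> n" and "m \<le> n" "n \<le> M"
  shows "norm (x n - x m) \<le> (exp (\<Sum>j=m..<n. \<kappa> j) - 1) * norm (x m)"
  using \<open>m \<le> n\<close> \<open>n \<le> M\<close>
proof (induction n rule: dec_induct)
  case base
  then show ?case by simp
next
  case (step n)
  let ?E = "exp (\<Sum>j=m..<n. \<kappa> j)"
  have IH: "norm (x n - x m) \<le> (?E - 1) * norm (x m)" using step by simp
  have xn: "norm (x n) \<le> ?E * norm (x m)"
    using norm_triangle_ineq[of "x n - x m" "x m"] IH by (simp add: algebra_simps)
  have "norm (x (Suc n) - x m) \<le> norm (x (Suc n) - x n) + norm (x n - x m)"
    using norm_triangle_ineq[of "x (Suc n) - x n" "x n - x m"] by simp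
  also have "\<dots> \<le> \<kappa> n * (?E * norm (x m)) + (?E - 1) * norm (x m)"
    using assms(1)[of n] step.prems IH mult_left_mono[OF xn nonneg[of n]] by simp
  also have "\<dots> = ((1 + \<kappa> n) * ?E - 1) * norm (x m)" by (simp add: algebra_simps)
  also have "\<dots> \<le> (exp (\<kappa> n) * ?E - 1) * norm (x m)"
    by (intro mult_right_mono diff_right_mono) auto
  also have "exp (\<kappa> n) * ?E = exp (\<Sum>j=m..<Suc n. \<kappa> j)"
    using step.hyps by (simp add: exp_add)
  finally show ?case .
qed

lemma norm_cis_minus_linear: "norm (cis t - 1 - \<i> * of_real t) \<le> t\<^sup>2"
proof -
  have "norm (exp (\<i> * of_real t) - (\<Sum>k\<le>1. (\<i> * of_real t) ^ k / fact k))
        \<le> exp \<bar>Re (\<i> * of_real t)\<bar> * norm (\<i> * of_real t) ^ Suc 1 / fact 1"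
    by (rule Taylor_exp)
  then show ?thesis
    by (simp add: cis_conv_exp norm_mult power2_eq_square algebra_simps)
qed

lemma norm_cis_diff_le: "norm (cis a - cis b) \<le> \<bar>a - b\<bar>"
proof -
  have "(norm (cis a - cis b))\<^sup>2 = 2 - 2 * cos (a - b)"
    unfolding cmod_power2 by (simp add: cos_diff power2_eq_square algebra_simps)
  also have "\<dots> = (2 * sin ((a - b) / 2))\<^sup>2"
    using cos_double_sin[of "(a - b) / 2"] by (simp only: mult_2 field_sum_of_halves power_mult_distrib) simp
  also have "\<dots> \<le> (a - b)\<^sup>2"
    using abs_sin_x_le_abs_x[of "(a - b) / 2"] by (intro abs_le_square_iff[THEN iffD1]) simp
  finally show ?thesis by (metis abs_le_square_iff abs_norm_cancel)
qed

text \<open>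
  A linear chirp driving \<open>u\<^sub>n\<^sub>+\<^sub>1 = u\<^sub>n - e\<^sub>n \<cdot> cnj u\<^sub>n\<close>: the rotation \<open>\<zeta>\<^sub>n = e\<^sub>n\<^sub>+\<^sub>1 / e\<^sub>n\<close> turns twice around the
  circle. The change of variables \<open>v = u - c e \<cdot> cnj u\<close> with \<open>c = 1/(1 - \<zeta>)\<close> would remove the
  first order term; the regularisation of \<open>c\<close> at scale \<open>1/N\<close> keeps it bounded at the resonance \<open>\<zeta> = 1\<close>.
\<close>

locale chirp =
  fixes eps :: real and N :: nat and z0 :: complex and e u :: "nat \<Rightarrow> complex"
  assumes eps: "0 < eps" "eps \<le> 1/10000" and N: "1 \<le> N" and z0: "norm z0 = 1"
    and e0: "norm (e 0) = eps / real N"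
    and e_Suc: "\<And>n. e (Suc n) = z0 * cis (2 * pi * real n / real (N\<^sup>2)) * e n"
    and u_Suc: "\<And>n. n < 2 * N\<^sup>2 \<Longrightarrow> u (Suc n) = u n - e n * cnj (u n)"
begin

definition "\<delta> = eps / real N"
definition "\<zeta> n = z0 * cis (2 * pi * real n / real (N\<^sup>2))"
definition "D n = norm (1 - \<zeta> n) ^ 2 + (1 / real N)\<^sup>2"
definition "c n = (1 - cnj (\<zeta> n)) / of_real (D n)"
definition "v n = u n - c n * e n * cnj (u n)"
text \<open>The first-order term that survives the change of variables. It would vanish for a
  constant c = 1/(1 - \<zeta>), so it measures only the regularisation of \<open>c\<close> and the
  drift of \<open>c\<close> from one step to the next.\<close>

definition "g n = c n - 1 - c (Suc n) * \<zeta> n"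
definition "phase n = (\<Sum>j<n. \<delta>\<^sup>2 * Im (c j))"

lemma \<delta>_pos: "0 < \<delta>" and \<delta>_le: "\<delta> \<le> 1"
  using eps N by (auto simp: \<delta>_def field_simps)

lemma norm_\<zeta> [simp]: "norm (\<zeta> n) = 1"
  using z0 by (simp add: \<zeta>_def norm_mult)

lemma norm_e [simp]: "norm (e n) = \<delta>"
  by (induction n) (use e0 z0 in \<open>auto simp: \<delta>_def e_Suc norm_mult\<close>)

section \<open>Size of the coefficients \<open>c\<close> and \<open>g\<close>\<close>

lemma D_pos: "0 < D n"
  unfolding D_def using N by (intro add_nonneg_pos) auto

lemma norm_c: "norm (c n) = norm (1 - \<zeta> n) / D n"
proof -
  have "norm (1 - cnj (\<zeta> n)) = norm (1 - \<zeta> n)"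
    by (metis complex_cnj_diff complex_cnj_one complex_mod_cnj)
  then show ?thesis using D_pos[of n] by (simp add: c_def norm_divide)
qed

lemma norm_c_sq_le: "norm (c n) ^ 2 \<le> 1 / D n"
proof -
  have "norm (c n) ^ 2 = norm (1 - \<zeta> n) ^ 2 / D n / D n"
    by (simp add: norm_c power_divide power2_eq_square)
  also have "\<dots> \<le> D n / D n / D n"
    using D_pos[of n] by (intro divide_right_mono) (auto simp: D_def)
  finally show ?thesis using D_pos[of n] by simp
qed

text \<open>AM-GM applied to the two terms of \<open>D n\<close>. This is the gain from the
  regularisation: the correction \<open>c n * e n\<close> stays below eps/2 even at the
  resonance.\<close>

lemma norm_c_le: "norm (c n) \<le> real N / 2"
proof -
  have "0 \<le> (norm (1 - \<zeta> n) - 1 / real N)\<^sup>2" by simp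
  then have "2 * norm (1 - \<zeta> n) / real N \<le> D n"
    by (simp add: D_def power2_diff)
  then show ?thesis using D_pos[of n] N by (simp add: norm_c field_simps)
qed

text \<open>On the circle 1/(1 - \<zeta>) has real part 1/2 however close \<zeta> is to 1. So only
  the imaginary part of \<open>c\<close>, which rotates without changing the modulus, can become
  large.\<close>

lemma Re_c: "0 \<le> Re (c n)" "Re (c n) \<le> 1"
proof -
  have eq: "norm (1 - \<zeta> n) ^ 2 = 2 * (1 - Re (\<zeta> n))"
    using norm_\<zeta>[of n] unfolding cmod_power2 by (simp add: power2_eq_square algebra_simps cmod_def)
  have Re: "Re (c n) = (1 - Re (\<zeta> n)) / D n" by (simp add: c_def)
  have "0 \<le> 1 - Re (\<zeta> n)" using complex_Re_le_cmod[of "\<zeta> n"] by simp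
  then show "0 \<le> Re (c n)" "Re (c n) \<le> 1"
    using D_pos[of n] eq by (auto simp: Re D_def intro: order_trans[OF _ zero_le_power2] add_increasing2)
qed

lemma one_minus_c: "1 - c n * (1 - \<zeta> n) = of_real ((1 / real N)\<^sup>2 / D n)"
proof -
  have "(1 - cnj (\<zeta> n)) * (1 - \<zeta> n) = of_real (norm (1 - \<zeta> n) ^ 2)"
    unfolding complex_norm_square by (simp add: mult.commute)
  then have "c n * (1 - \<zeta> n) = of_real (norm (1 - \<zeta> n) ^ 2 / D n)"
    by (simp add: c_def)
  moreover have "1 - norm (1 - \<zeta> n) ^ 2 / D n = (1 / real N)\<^sup>2 / D n"
    using D_pos[of n] by (simp add: D_def field_simps)
  ultimately show ?thesis by (metis of_real_1 of_real_diff)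
qed

text \<open>The derivative of 1/(1 - \<zeta>) has size 1/|1 - \<zeta>|^2, regularised here to 1/D,
  and one step moves \<zeta> by an arc of length 2 pi / N^2.\<close>

lemma norm_c_diff_le: "norm (c (Suc n) - c n) \<le> 2 * pi / real (N\<^sup>2) * (1 / D n + 1 / D (Suc n))"
proof -
  define w w' where "w = 1 - \<zeta> n" and "w' = 1 - \<zeta> (Suc n)"
  define \<eta> where "\<eta> = 1 / real N"
  have D: "D n = norm w ^ 2 + \<eta>\<^sup>2" "D (Suc n) = norm w' ^ 2 + \<eta>\<^sup>2"
    by (auto simp: D_def w_def w'_def \<eta>_def)
  have c: "c n = cnj w / of_real (D n)" "c (Suc n) = cnj w' / of_real (D (Suc n))"
    by (auto simp: c_def w_def w'_def)
  have DD: "of_real (D n) = w * cnj w + of_real (\<eta>\<^sup>2)" "of_real (D (Suc n)) = w' * cnj w' + of_real (\<eta>\<^sup>2)"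
    unfolding D by (simp_all only: of_real_add complex_norm_square)
  have ww: "norm (w' - w) \<le> 2 * pi / real (N\<^sup>2)"
  proof -
    have "norm (w' - w) = norm (z0 * (cis (2 * pi * real n / real (N\<^sup>2)) - cis (2 * pi * real (Suc n) / real (N\<^sup>2))))"
      by (simp add: w_def w'_def \<zeta>_def algebra_simps)
    also have "\<dots> \<le> \<bar>2 * pi * real n / real (N\<^sup>2) - 2 * pi * real (Suc n) / real (N\<^sup>2)\<bar>"
      unfolding norm_mult z0 mult_1_left by (rule norm_cis_diff_le)
    also have "\<dots> = 2 * pi / real (N\<^sup>2)"
      by (simp add: diff_divide_distrib[symmetric] algebra_simps)
    finally show ?thesis .
  qed
  have nz: "complex_of_real (D n) \<noteq> 0" "complex_of_real (D (Suc n)) \<noteq> 0"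
    using D_pos[of n] D_pos[of "Suc n"] by auto
  have "c (Suc n) - c n = (cnj w' * of_real (D n) - cnj w * of_real (D (Suc n))) / (of_real (D n) * of_real (D (Suc n)))"
    unfolding c using nz by (simp add: field_simps)
  \<comment> \<open>The products of both denominators cancel so that every remaining term carries
    the small factor w' - w or its conjugate.\<close>
  also have "cnj w' * of_real (D n) - cnj w * of_real (D (Suc n))
      = cnj w * cnj w' * (w - w') + of_real (\<eta>\<^sup>2) * (cnj w' - cnj w)"
    unfolding DD by (simp add: algebra_simps)
  finally have "norm (c (Suc n) - c n)
     = norm (cnj w * cnj w' * (w - w') + of_real (\<eta>\<^sup>2) * (cnj w' - cnj w)) / (D n * D (Suc n))"
    using D_pos[of n] D_pos[of "Suc n"] by (simp add: norm_divide norm_mult)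
  also have "\<dots> \<le> (norm (w' - w) * (norm w * norm w' + \<eta>\<^sup>2)) / (D n * D (Suc n))"
  proof (rule divide_right_mono)
    have "norm (cnj w' - cnj w) = norm (w' - w)"
      by (metis complex_cnj_diff complex_mod_cnj)
    then show "norm (cnj w * cnj w' * (w - w') + of_real (\<eta>\<^sup>2) * (cnj w' - cnj w)) \<le> norm (w' - w) * (norm w * norm w' + \<eta>\<^sup>2)"
      by (intro norm_triangle_le) (simp add: norm_mult norm_minus_commute[of w] norm_power distrib_left mult.commute)
  qed (use D_pos[of n] D_pos[of "Suc n"] in simp)
  also have "\<dots> \<le> (2 * pi / real (N\<^sup>2) * (D n + D (Suc n))) / (D n * D (Suc n))"
  proof (intro divide_right_mono mult_mono ww)
    have "norm w * norm w' \<le> norm w ^ 2 + norm w' ^ 2"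
      using sum_squares_bound[of "norm w" "norm w'"] mult_nonneg_nonneg[of "norm w" "norm w'", OF norm_ge_zero norm_ge_zero]
      unfolding mult.assoc by linarith
    then show "norm w * norm w' + \<eta>\<^sup>2 \<le> D n + D (Suc n)" unfolding D 
      using zero_le_power2[of \<eta>] by linarith
  qed (use D_pos[of n] D_pos[of "Suc n"] in auto)
  also have "\<dots> = 2 * pi / real (N\<^sup>2) * (1 / D n + 1 / D (Suc n))"
    using D_pos[of n] D_pos[of "Suc n"] by (simp add: field_simps)
  finally show ?thesis .
qed

text \<open>The regularisation error contributes 1 to the constant, and the drift of
  \<open>c\<close> contributes 7, an upper bound for 2 pi. Both are Lorentzians, so their sum over
  the chirp is controlled by \<open>sum_D\<close>.\<close>

lemma norm_g_le: "norm (g n) \<le> 8 / (real N)\<^sup>2 * (1 / D n + 1 / D (Suc n))"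
proof -
  have "g n = - (1 - c n * (1 - \<zeta> n)) - (c (Suc n) - c n) * \<zeta> n"
    by (simp add: g_def algebra_simps)
  then have "norm (g n) \<le> norm (1 - c n * (1 - \<zeta> n)) + norm (c (Suc n) - c n)"
    using norm_triangle_ineq4[of "- (1 - c n * (1 - \<zeta> n))" "(c (Suc n) - c n) * \<zeta> n"]
    unfolding norm_minus_cancel by (simp add: norm_mult del: minus_diff_eq)
  also have "norm (1 - c n * (1 - \<zeta> n)) = (1 / real N)\<^sup>2 / D n"
    unfolding one_minus_c norm_of_real using D_pos[of n] by simp
  also have "\<dots> \<le> 1 / (real N)\<^sup>2 * (1 / D n + 1 / D (Suc n))"
    using D_pos[of "Suc n"] by (simp add: power_divide distrib_left mult.commute)
  also have "norm (c (Suc n) - c n) \<le> 7 / (real N)\<^sup>2 * (1 / D n + 1 / D (Suc n))"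
  proof (rule order_trans[OF norm_c_diff_le mult_right_mono])
    have "2 * pi \<le> 7" using pi_approx by simp
    then show "2 * pi / real (N\<^sup>2) \<le> 7 / (real N)\<^sup>2"
      by (simp add: divide_right_mono)
  qed (use D_pos[of n] D_pos[of "Suc n"] in auto)
  finally show ?thesis by (simp add: algebra_simps add_divide_distrib)
qed

text \<open>Two facts drive the computation: \<open>e\<close> is multiplied by \<zeta> in each step,
  and e times its conjugate is \<delta>^2. The second order term contains \<delta>^2
  \<open>c n\<close> \<open>u n\<close>, whose imaginary coefficient is the source of the
  rotation.\<close>

lemma v_Suc:
  assumes "n < 2 * N\<^sup>2"
  shows "v (Suc n) = v n + g n * e n * cnj (u n) + of_real (\<delta>\<^sup>2) * (c n - 1 - g n) * u n"
proof -
  have ee: "e n * cnj (e n) = of_real (\<delta>\<^sup>2)"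
    by (metis complex_norm_square norm_e)
  have cz: "c n - 1 - g n = c (Suc n) * \<zeta> n" by (simp add: g_def)
  have es: "e (Suc n) = \<zeta> n * e n" by (simp add: e_Suc \<zeta>_def)
  show ?thesis
    unfolding cz v_def es u_Suc[OF assms] ee[symmetric] by (simp add: g_def algebra_simps)
qed

lemma u_v: "norm (u n - v n) \<le> eps / 2 * norm (u n)"
proof -
  have "norm (u n - v n) = norm (c n) * \<delta> * norm (u n)" by (simp add: v_def norm_mult)
  also have "\<dots> \<le> real N / 2 * \<delta> * norm (u n)"
    using norm_c_le[of n] \<delta>_pos by (intro mult_right_mono) auto
  finally show ?thesis using N by (simp add: \<delta>_def)
qed

lemma u_v_bounds: "norm (u n) \<le> 2 * norm (v n)" "norm (v n) \<le> 2 * norm (u n)"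
proof -
  have "eps / 2 * norm (u n) \<le> 1/2 * norm (u n)" using eps by (intro mult_right_mono) auto
  then have "norm (u n - v n) \<le> 1/2 * norm (u n)" using u_v[of n] by linarith
  then show "norm (u n) \<le> 2 * norm (v n)" "norm (v n) \<le> 2 * norm (u n)"
    using norm_triangle_ineq2[of "u n" "v n"] norm_triangle_ineq3[of "u n" "v n"] by (auto simp: abs_le_iff)
qed

text \<open>Relative error of one step of \<open>v\<close> against a pure rotation. The
  \<open>g\<close> term occurs twice because \<delta>^2 is bounded by \<delta> in its second
  appearance; \<delta>^2 comes from Re c - 1. Of the third order terms, one comes from replacing
  \<open>u\<close> by \<open>v\<close> in the rotation and two from linearising \<open>cis\<close>.
  The outer 2 passes from the norm of \<open>u\<close> to that of \<open>v\<close>.\<close>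

definition "\<kappa> n = 2 * (2 * \<delta> * norm (g n) + \<delta>\<^sup>2 + 3 * \<delta> ^ 3 / D n)"

lemma \<kappa>_nonneg: "0 \<le> \<kappa> n"
  using \<delta>_pos D_pos[of n] by (simp add: \<kappa>_def)

lemma v_step:
  assumes "n < 2 * N\<^sup>2"
  shows "norm (v (Suc n) - cis (\<delta>\<^sup>2 * Im (c n)) * v n) \<le> \<kappa> n * norm (v n)"
proof -
  let ?y = "\<delta>\<^sup>2 * Im (c n)"
  have y: "\<bar>Im (c n)\<bar> \<le> norm (c n)" by (rule abs_Im_le_cmod)
  have c: "c n = of_real (Re (c n)) + \<i> * of_real (Im (c n))" by (rule complex_eq)
  have uv: "u n - v n = c n * e n * cnj (u n)" by (simp add: v_def)
  \<comment> \<open>The rotation i y is split off from the second order term. It acts on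
    \<open>u\<close>, while \<open>cis\<close> acts on \<open>v\<close>, hence the term with u - v;
    the last term is the Taylor remainder of \<open>cis\<close>.\<close>
  have key: "v (Suc n) - cis ?y * v n
      = g n * e n * cnj (u n) + of_real (\<delta>\<^sup>2) * (of_real (Re (c n) - 1) - g n) * u n
        + \<i> * of_real ?y * (u n - v n) - (cis ?y - 1 - \<i> * of_real ?y) * v n"
    unfolding v_Suc[OF assms] by (subst c) (simp add: algebra_simps)
  have a1: "norm (g n * e n * cnj (u n)) = norm (g n) * \<delta> * norm (u n)" by (simp add: norm_mult)
  have a2: "norm (of_real (\<delta>\<^sup>2) * (of_real (Re (c n) - 1) - g n) * u n) \<le> (\<delta>\<^sup>2 + \<delta> * norm (g n)) * norm (u n)"
  proof -
    have "norm (of_real (Re (c n) - 1) - g n) \<le> \<bar>Re (c n) - 1\<bar> + norm (g n)"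
      by (metis norm_of_real norm_triangle_ineq4)
    also have "\<dots> \<le> 1 + norm (g n)" using Re_c[of n] by simp
    finally have "\<delta>\<^sup>2 * norm (of_real (Re (c n) - 1) - g n) \<le> \<delta>\<^sup>2 * (1 + norm (g n))"
      by (intro mult_left_mono) auto
    also have "\<dots> \<le> \<delta>\<^sup>2 + \<delta> * norm (g n)"
      using \<delta>_pos \<delta>_le by (simp add: algebra_simps power2_eq_square mult_left_le_one_le mult_right_mono)
    finally have "\<delta>\<^sup>2 * norm (of_real (Re (c n) - 1) - g n) * norm (u n) \<le> (\<delta>\<^sup>2 + \<delta> * norm (g n)) * norm (u n)"
      by (intro mult_right_mono) auto
    then show ?thesis by (simp add: norm_mult norm_power)
  qed
  have a3: "norm (\<i> * of_real ?y * (u n - v n)) \<le> \<delta> ^ 3 / D n * norm (u n)"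
  proof -
    have "norm (\<i> * of_real ?y * (u n - v n)) = \<delta> ^ 3 * (\<bar>Im (c n)\<bar> * norm (c n)) * norm (u n)"
      unfolding uv using \<delta>_pos by (simp add: norm_mult abs_mult power2_eq_square power3_eq_cube norm_power)
    also have "\<dots> \<le> \<delta> ^ 3 * (norm (c n) * norm (c n)) * norm (u n)"
      using y \<delta>_pos by (intro mult_right_mono mult_left_mono) auto
    also have "\<dots> \<le> \<delta> ^ 3 * (1 / D n) * norm (u n)"
      using norm_c_sq_le[of n] \<delta>_pos by (intro mult_right_mono mult_left_mono) (auto simp: power2_eq_square)
    finally show ?thesis by simp
  qed
  have a4: "norm ((cis ?y - 1 - \<i> * of_real ?y) * v n) \<le> 2 * \<delta> ^ 3 / D n * norm (u n)"
  proof -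
    have "norm (cis ?y - 1 - \<i> * of_real ?y) \<le> ?y\<^sup>2" by (rule norm_cis_minus_linear)
    also have "\<dots> = \<delta> ^ 4 * \<bar>Im (c n)\<bar> ^ 2" by (simp add: power_mult_distrib)
    also have "\<dots> \<le> \<delta> ^ 4 * norm (c n) ^ 2"
      using y by (intro mult_left_mono power_mono) auto
    also have "\<dots> \<le> \<delta> ^ 3 * (1 / D n)"
      using norm_c_sq_le[of n] \<delta>_pos \<delta>_le by (intro mult_mono power_decreasing) auto
    finally have "norm (cis ?y - 1 - \<i> * of_real ?y) * norm (v n) \<le> \<delta> ^ 3 * (1 / D n) * (2 * norm (u n))"
      using u_v_bounds[of n] \<delta>_pos D_pos[of n] by (intro mult_mono) auto
    then show ?thesis unfolding norm_mult by (simp add: algebra_simps)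
  qed
  have "norm (v (Suc n) - cis ?y * v n) \<le> (2 * \<delta> * norm (g n) + \<delta>\<^sup>2 + 3 * \<delta> ^ 3 / D n) * norm (u n)"
  proof -
    have "norm (v (Suc n) - cis ?y * v n) \<le> norm (g n) * \<delta> * norm (u n) + (\<delta>\<^sup>2 + \<delta> * norm (g n)) * norm (u n)
      + \<delta> ^ 3 / D n * norm (u n) + 2 * \<delta> ^ 3 / D n * norm (u n)"
      unfolding key
      by (rule order_trans[OF norm_triangle_ineq4] order_trans[OF norm_triangle_ineq] add_mono a2 a3 a4 eq_refl[OF a1])+
    also have "\<dots> = (2 * \<delta> * norm (g n) + \<delta>\<^sup>2 + 3 * \<delta> ^ 3 / D n) * norm (u n)"
      by (simp add: algebra_simps add_divide_distrib)
    finally show ?thesis .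
  qed
  also have "\<dots> \<le> (2 * \<delta> * norm (g n) + \<delta>\<^sup>2 + 3 * \<delta> ^ 3 / D n) * (2 * norm (v n))"
    using u_v_bounds[of n] \<kappa>_nonneg[of n] by (intro mult_left_mono) (auto simp: \<kappa>_def)
  finally show ?thesis by (simp add: \<kappa>_def algebra_simps)
qed

section \<open>Total error of a chirp\<close>

lemma D_periodic: "D (n + N\<^sup>2) = D n"
proof -
  have "cis (2 * pi * real (n + N\<^sup>2) / real (N\<^sup>2)) = cis (2 * pi * real n / real (N\<^sup>2)) * cis (2 * pi)"
    using N by (simp only: cis_mult) (simp add: field_simps)
  then show ?thesis by (simp add: D_def \<zeta>_def)
qed

text \<open>The chirp runs through two periods of \<zeta>; the third period makes room for the
  shifted terms \<open>D (Suc n)\<close> in the bound for \<open>g\<close>.\<close>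

lemma sum_D: "(\<Sum>n<3 * N\<^sup>2. 1 / D n) \<le> 12 * real N ^ 3"
proof -
  have 1: "(\<Sum>n<N\<^sup>2. 1 / D n) \<le> 4 * real N ^ 3"
    using sum_lorentzian_over_roots[OF N z0] by (simp add: D_def \<zeta>_def)
  have split: "(\<Sum>n<N\<^sup>2 + m. 1 / D n) = (\<Sum>n<N\<^sup>2. 1 / D n) + (\<Sum>n<m. 1 / D n)" for m
    using sum.atLeastLessThan_concat[of 0 "N\<^sup>2" "N\<^sup>2 + m" "\<lambda>n. 1 / D n"]
      sum.shift_bounds_nat_ivl[of "\<lambda>n. 1 / D n" 0 "N\<^sup>2" m]
    by (simp add: D_periodic atLeast0LessThan add.commute)
  have "(\<Sum>n<3 * N\<^sup>2. 1 / D n) = (\<Sum>n<N\<^sup>2 + (N\<^sup>2 + N\<^sup>2). 1 / D n)"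
    by (rule arg_cong[where f = "\<lambda>k. sum _ {..<k}"]) simp
  also have "\<dots> = 3 * (\<Sum>n<N\<^sup>2. 1 / D n)" unfolding split by simp
  finally show ?thesis using 1 by linarith
qed

text \<open>With Lorentzian sums of order N^3, 2 N^2 steps and \<delta> = eps/N, the three kinds of
  error add up to multiples of eps, eps^2 and eps^3. All powers of N cancel, so the chirp can be
  made as long as the phase requires at fixed eps.\<close>

lemma sum_\<kappa>: "(\<Sum>n<2 * N\<^sup>2. \<kappa> n) \<le> 900 * eps"
proof -
  let ?S = "\<Sum>n<3 * N\<^sup>2. 1 / D n"
  have sub: "(\<Sum>n\<in>A. 1 / D n) \<le> ?S" if "A \<subseteq> {..<3 * N\<^sup>2}" for A
    using that D_pos by (intro sum_mono2) (auto simp: less_imp_le)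
  have s1: "(\<Sum>n<2 * N\<^sup>2. 1 / D n) \<le> ?S" by (rule sub) auto
  have s2: "(\<Sum>n<2 * N\<^sup>2. 1 / D (Suc n)) \<le> ?S"
  proof -
    have "(\<Sum>n<2 * N\<^sup>2. 1 / D (Suc n)) = (\<Sum>n\<in>Suc ` {..<2 * N\<^sup>2}. 1 / D n)"
      by (simp add: sum.reindex)
    also have "\<dots> \<le> ?S" 
    proof (rule sub, safe)
      fix n assume "n < 2 * N\<^sup>2"
      moreover have "1 \<le> N\<^sup>2" using N by simp
      ultimately show "Suc n < 3 * N\<^sup>2" by linarith
    qed
    finally show ?thesis .
  qed
  have "(\<Sum>n<2 * N\<^sup>2. \<kappa> n) \<le> (\<Sum>n<2 * N\<^sup>2. (32 * \<delta> / (real N)\<^sup>2) * (1 / D n) + (32 * \<delta> / (real N)\<^sup>2) * (1 / D (Suc n)) + 2 * \<delta>\<^sup>2 + 6 * \<delta> ^ 3 * (1 / D n))"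
  proof (rule sum_mono)
    fix n
    have "4 * \<delta> * norm (g n) \<le> 4 * \<delta> * (8 / (real N)\<^sup>2 * (1 / D n + 1 / D (Suc n)))"
      using norm_g_le[of n] \<delta>_pos by (intro mult_left_mono) auto
    also have "\<dots> = (32 * \<delta> / (real N)\<^sup>2) * (1 / D n) + (32 * \<delta> / (real N)\<^sup>2) * (1 / D (Suc n))"
      by (simp add: distrib_left)
    finally show "\<kappa> n \<le> (32 * \<delta> / (real N)\<^sup>2) * (1 / D n) + (32 * \<delta> / (real N)\<^sup>2) * (1 / D (Suc n)) + 2 * \<delta>\<^sup>2 + 6 * \<delta> ^ 3 * (1 / D n)"
      by (simp add: \<kappa>_def)
  qed
  also have "\<dots> = (32 * \<delta> / (real N)\<^sup>2) * (\<Sum>n<2 * N\<^sup>2. 1 / D n) + (32 * \<delta> / (real N)\<^sup>2) * (\<Sum>n<2 * N\<^sup>2. 1 / D (Suc n))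
      + 4 * (real N)\<^sup>2 * \<delta>\<^sup>2 + 6 * \<delta> ^ 3 * (\<Sum>n<2 * N\<^sup>2. 1 / D n)"
    unfolding sum.distrib sum_distrib_left[symmetric] by simp
  also have "\<dots> \<le> (32 * \<delta> / (real N)\<^sup>2) * (12 * real N ^ 3) + (32 * \<delta> / (real N)\<^sup>2) * (12 * real N ^ 3)
      + 4 * (real N)\<^sup>2 * \<delta>\<^sup>2 + 6 * \<delta> ^ 3 * (12 * real N ^ 3)"
    using s1 s2 sum_D \<delta>_pos by (intro add_mono mult_left_mono order_refl) auto
  also have "\<dots> = 768 * eps + 4 * eps\<^sup>2 + 72 * eps ^ 3"
    using N by (simp add: \<delta>_def power_divide) (simp add: power2_eq_square power3_eq_cube)
  also have "\<dots> \<le> 768 * eps + 4 * eps + 72 * eps"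
    using eps power_decreasing[of 1 2 eps] power_decreasing[of 1 3 eps] by auto
  finally show ?thesis using eps by linarith
qed

text \<open>\<open>v\<close> in the frame that follows the accumulated rotation; its steps consist
  of the error \<kappa> alone.\<close>

definition "x n = cis (- phase n) * v n"

lemma norm_x [simp]: "norm (x n) = norm (v n)"
  by (simp add: x_def norm_mult)

lemma x_close:
  assumes "m \<le> n" "n \<le> 2 * N\<^sup>2"
  shows "norm (x n - x m) \<le> 1800 * eps * norm (x m)"
proof -
  have step: "norm (x (Suc k) - x k) \<le> \<kappa> k * norm (x k)" if "k < 2 * N\<^sup>2" for k
  proof -
    have "cis (- phase k) = cis (- phase (Suc k)) * cis (\<delta>\<^sup>2 * Im (c k))"
      by (simp add: cis_mult phase_def)
    then have "x (Suc k) - x k = cis (- phase (Suc k)) * (v (Suc k) - cis (\<delta>\<^sup>2 * Im (c k)) * v k)"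
      by (simp add: x_def algebra_simps)
    then have "norm (x (Suc k) - x k) = norm (v (Suc k) - cis (\<delta>\<^sup>2 * Im (c k)) * v k)"
      by (simp add: norm_mult)
    then show ?thesis using v_step[OF that] by simp
  qed
  have "norm (x n - x m) \<le> (exp (\<Sum>j=m..<n. \<kappa> j) - 1) * norm (x m)"
    by (rule relative_gronwall[where M = "2 * N\<^sup>2"]) (use step \<kappa>_nonneg assms in auto)
  also have "\<dots> \<le> 1800 * eps * norm (x m)"
  proof (rule mult_right_mono)
    let ?s = "\<Sum>j=m..<n. \<kappa> j"
    have "?s \<le> (\<Sum>n<2 * N\<^sup>2. \<kappa> n)"
      using assms \<kappa>_nonneg by (intro sum_mono2) auto
    then have s: "?s \<le> 900 * eps" using sum_\<kappa> by linarith
    moreover have "0 \<le> ?s" using \<kappa>_nonneg by (intro sum_nonneg) auto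
    \<comment> \<open>Since s is at most 900 eps < 1, the quadratic bound gives exp s - 1 at most 2
      s, hence the constant 1800.\<close>
    ultimately have "exp ?s \<le> 1 + ?s + ?s\<^sup>2" using eps by (intro exp_bound) auto
    moreover have "?s\<^sup>2 \<le> ?s" using s eps \<open>0 \<le> ?s\<close> power_decreasing[of 1 2 ?s] by auto
    ultimately show "exp ?s - 1 \<le> 1800 * eps" using s by linarith
  qed simp
  finally show ?thesis .
qed

text \<open>Unwinding the phase leaves the modulus alone, so \<open>x_close\<close> bounds the
  change of the norm of \<open>v\<close> by 1800 eps relatively. Passing between \<open>u\<close>
  and \<open>v\<close> at both ends costs only a few more eps.\<close>

lemma norm_u_close:
  assumes "n \<le> 2 * N\<^sup>2"
  shows "\<bar>norm (u n) - norm (u 0)\<bar> \<le> 2000 * eps * norm (u 0)"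
proof -
  define a b a0 b0 where "a = norm (u n)" "b = norm (v n)" "a0 = norm (u 0)" "b0 = norm (v 0)"
  note d = this
  have nn: "0 \<le> a" "0 \<le> b" "0 \<le> a0" "0 \<le> b0" by (auto simp: d)
  have ab: "\<bar>a - b\<bar> \<le> eps * a / 2" "\<bar>a0 - b0\<bar> \<le> eps * a0 / 2"
    unfolding d using u_v[of n] u_v[of 0] norm_triangle_ineq3[of "u n" "v n"] norm_triangle_ineq3[of "u 0" "v 0"]
    by (auto simp: algebra_simps)
  have bb: "\<bar>b - b0\<bar> \<le> 1800 * (eps * b0)"
    unfolding d using x_close[of 0 n] assms norm_triangle_ineq3[of "x n" "x 0"] by auto
  have e: "eps * t \<le> t / 10000" "0 \<le> eps * t" if "0 \<le> t" for t
    using that eps mult_right_mono[of eps "1/10000" t] by auto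
  have "b0 \<le> a0 * (10001/10000)" using ab(2) e[of a0] nn by linarith
  then have eb: "eps * b0 \<le> eps * a0 * (10001/10000)" using eps by simp
  \<comment> \<open>A crude first bound, used to turn the error eps a, relative to the final norm,
    into one relative to the initial norm.\<close>
  have "a \<le> 2 * a0" using ab bb e[of a] e[of a0] e[of b0] eb nn by linarith
  then have ea: "eps * a \<le> 2 * (eps * a0)" using eps by simp
  have "\<bar>a - a0\<bar> \<le> 2000 * (eps * a0)" using ab bb ea eb e[of a0] nn by linarith
  then show ?thesis by (simp add: d)
qed

text \<open>Up to errors of order eps, \<open>v n\<close> is \<open>v m\<close> rotated by an angle
  between pi/3 and pi, and such a rotation has chord at least 1. The upper limit pi excludes a
  rotation that returns to its start.\<close>

lemma u_moves:
  assumes mn: "m \<le> n" "n \<le> 2 * N\<^sup>2" and ph: "pi / 3 \<le> phase n - phase m" "phase n - phase m \<le> pi"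
  shows "norm (u 0) / 2 \<le> norm (u n - u m)"
proof -
  have "(norm (cis (phase n) - cis (phase m)))\<^sup>2 = 2 - 2 * cos (phase n - phase m)"
    unfolding cmod_power2 by (simp add: cos_diff power2_eq_square algebra_simps)
  moreover have "cos (phase n - phase m) \<le> cos (pi / 3)"
    using ph by (intro cos_monotone_0_pi_le) auto
  ultimately have "1\<^sup>2 \<le> (norm (cis (phase n) - cis (phase m)))\<^sup>2" by (simp add: cos_60)
  then have c1: "1 \<le> norm (cis (phase n) - cis (phase m))" by (rule power2_le_imp_le) simp
  have vx: "v k = cis (phase k) * x k" for k
    unfolding x_def mult.assoc[symmetric] cis_mult by simp
  have "(cis (phase n) - cis (phase m)) * x m = (v n - v m) - cis (phase n) * (x n - x m)"
    unfolding vx by (simp add: algebra_simps)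
  then have "norm ((cis (phase n) - cis (phase m)) * x m) \<le> norm (v n - v m) + norm (cis (phase n) * (x n - x m))"
    using norm_triangle_ineq4[of "v n - v m" "cis (phase n) * (x n - x m)"] by simp
  then have "norm (cis (phase n) - cis (phase m)) * norm (x m) \<le> norm (v n - v m) + norm (x n - x m)"
    by (simp only: norm_mult norm_cis mult_1_left)
  moreover have "1 * norm (x m) \<le> norm (cis (phase n) - cis (phase m)) * norm (x m)"
    using c1 by (intro mult_right_mono) auto
  ultimately have v1: "norm (v m) - 1800 * eps * norm (v m) \<le> norm (v n - v m)"
    using x_close[OF mn] by simp
  have "norm (v n - v m) = norm ((u n - u m) - (u n - v n) + (u m - v m))" by simp
  also have "\<dots> \<le> norm (u n - u m) + norm (u n - v n) + norm (u m - v m)"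
    by (rule order_trans[OF norm_triangle_ineq] add_mono norm_triangle_ineq4 order_refl)+
  finally have v2: "norm (v n - v m) \<le> norm (u n - u m) + norm (u n - v n) + norm (u m - v m)" .
  have e: "eps * t \<le> t / 10000" "0 \<le> eps * t" if "0 \<le> t" for t
    using that eps mult_right_mono[of eps "1/10000" t] by auto
  have un: "norm (u n - v n) \<le> norm (u n) / 20000" "norm (u m - v m) \<le> norm (u m) / 20000"
    using u_v[of n] u_v[of m] e[of "norm (u n)"] e[of "norm (u m)"] by auto
  have vm: "norm (u m) * (19999/20000) \<le> norm (v m)"
    using un(2) norm_triangle_ineq2[of "u m" "v m"] by linarith
  have um: "\<bar>norm (u n) - norm (u 0)\<bar> \<le> norm (u 0) / 5" "\<bar>norm (u m) - norm (u 0)\<bar> \<le> norm (u 0) / 5"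
    using norm_u_close[of n] norm_u_close[of m] mn e[of "norm (u 0)"] by auto
  show ?thesis using v1 v2 un vm um e[of "norm (v m)"] norm_ge_zero[of "v m"] norm_ge_zero[of "u 0"] by linarith
qed

section \<open>Phase gained after the resonance\<close>

text \<open>Without regularisation the imaginary part would be cot (t/2) / 2, about 1/t. For t at
  least 1/N the regularisation costs a factor 2 through D at most 2 t^2, and sin t at least t/2
  costs another.\<close>

lemma Im_c_ge:
  assumes \<zeta>: "\<zeta> n = cis t" and t: "1 / real N \<le> t" "t \<le> 1"
  shows "1 / (4 * t) \<le> Im (c n)"
proof -
  have t0: "0 < t" using t N by (auto intro: less_le_trans[of 0 "1 / real N"])
  have "norm (1 - \<zeta> n) \<le> t"
    using norm_cis_diff_le[of 0 t] t0 by (simp add: \<zeta>)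
  then have "norm (1 - \<zeta> n) ^ 2 \<le> t\<^sup>2" by (intro power_mono) auto
  moreover have "(1 / real N)\<^sup>2 \<le> t\<^sup>2" using t by (intro power_mono) auto
  ultimately have D: "D n \<le> 2 * t\<^sup>2" unfolding D_def by linarith
  have "t / 2 \<le> sin t"
  proof -
    have "\<bar>sin t - t\<bar> \<le> t\<^sup>2 / 2"
      using Maclaurin_sin_bound[of t 2] by (simp add: numeral_2_eq_2 sin_coeff_def)
    moreover have "t\<^sup>2 \<le> t" using t0 t power_decreasing[of 1 2 t] by auto
    ultimately show ?thesis by linarith
  qed
  then have "(t / 2) / (2 * t\<^sup>2) \<le> sin t / D n"
    using D D_pos[of n] t0 by (intro frac_le) auto
  also have "sin t / D n = Im (c n)" by (simp add: c_def \<zeta>)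
  also have "(t / 2) / (2 * t\<^sup>2) = 1 / (4 * t)" using t0 by (simp add: power2_eq_square)
  finally show ?thesis .
qed

text \<open>The frequency \<zeta> passes 1 during the first turn. The second turn of the chirp thus
  guarantees room after the resonance for every starting angle, that is, for every point of the
  circle.\<close>

lemma resonance:
  obtains p \<beta> where "p \<le> N\<^sup>2" "0 \<le> \<beta>" "\<beta> \<le> 2 * pi / (real N)\<^sup>2"
    "\<And>i. \<zeta> (p + i) = cis (\<beta> + 2 * pi * real i / (real N)\<^sup>2)"
proof -
  obtain \<theta> where \<theta>: "0 \<le> \<theta>" "\<theta> < 2 * pi" "z0 = cis \<theta>"
    using complex_unimodular_polar[OF z0] by (metis cis.ctr)
  \<comment> \<open>The real time at which the angle reaches 2 pi. Its ceiling \<open>p\<close> is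
    the first index at or past the resonance, and \<beta> is the overshoot, at most one grid
    step.\<close>
  define q where "q = (2 * pi - \<theta>) * (real N)\<^sup>2 / (2 * pi)"
  define p where "p = nat \<lceil>q\<rceil>"
  define \<beta> where "\<beta> = \<theta> + 2 * pi * real p / (real N)\<^sup>2 - 2 * pi"
  have N2: "0 < (real N)\<^sup>2" using N by simp
  have q0: "0 \<le> q" using \<theta> N2 by (simp add: q_def)
  then have p: "q \<le> real p" "real p \<le> q + 1" unfolding p_def by linarith+
  have qe: "\<theta> + 2 * pi * q / (real N)\<^sup>2 - 2 * pi = 0"
    using N2 by (simp add: q_def)
  have \<beta>: "\<beta> = 2 * pi / (real N)\<^sup>2 * (real p - q)"
    using qe by (simp add: \<beta>_def algebra_simps diff_divide_distrib)
  show ?thesis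
  proof
    have "q \<le> (real N)\<^sup>2" using \<theta> N2 by (simp add: q_def divide_le_eq mult.commute)
    then have "\<lceil>q\<rceil> \<le> int (N\<^sup>2)" by (simp add: ceiling_le_iff)
    then show "p \<le> N\<^sup>2" unfolding p_def by linarith
    show "0 \<le> \<beta>" unfolding \<beta> using p N2 by simp
    show "\<beta> \<le> 2 * pi / (real N)\<^sup>2"
      unfolding \<beta> using p N2 by (intro mult_left_le) auto
    fix i
    have "\<zeta> (p + i) = cis (\<theta> + 2 * pi * real (p + i) / (real N)\<^sup>2)"
      unfolding \<zeta>_def by (simp add: \<theta>(3) cis_mult)
    also have "\<theta> + 2 * pi * real (p + i) / (real N)\<^sup>2 = (\<beta> + 2 * pi * real i / (real N)\<^sup>2) + 2 * pi"
      by (simp add: \<beta>_def add_divide_distrib distrib_left)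
    finally show "\<zeta> (p + i) = cis (\<beta> + 2 * pi * real i / (real N)\<^sup>2)"
      by (simp flip: cis_mult)
  qed
qed

text \<open>At i steps after the resonance the phase gains at least eps^2 / (64 i), and the harmonic
  sum over the window below is at least ln q. The hypothesis on ln q makes the total gain at least
  2, which exceeds pi/3.\<close>

lemma phase_turns:
  assumes Nq: "N = 16 * q" and q: "2 \<le> q" and ln_q: "128 \<le> eps\<^sup>2 * ln (real q)"
  obtains m n where "m \<le> n" "n \<le> 2 * N\<^sup>2" "pi / 3 \<le> phase n - phase m" "phase n - phase m \<le> pi"
proof -
  obtain p \<beta> where p: "p \<le> N\<^sup>2" "0 \<le> \<beta>" "\<beta> \<le> 2 * pi / (real N)\<^sup>2"
    "\<And>i. \<zeta> (p + i) = cis (\<beta> + 2 * pi * real i / (real N)\<^sup>2)" using resonance by blast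
  have N2: "0 < (real N)\<^sup>2" using N by simp
  \<comment> \<open>The window where \<open>Im_c_ge\<close> applies: from i = N on the angle is at
    least 1/N, and below i = N^2/16 = 16 q^2 it is at most 1. The choice N = 16 q makes the quotient
    of its ends equal to q.\<close>
  have Im: "(real N)\<^sup>2 / (64 * real i) \<le> Im (c (p + i))" if i: "N \<le> i" "i < 16 * q\<^sup>2" for i
  proof -
    let ?t = "\<beta> + 2 * pi * real i / (real N)\<^sup>2"
    have i0: "1 \<le> real i" using i N by linarith
    have "?t \<le> 2 * pi / (real N)\<^sup>2 + 2 * pi * real i / (real N)\<^sup>2" using p by simp
    also have "\<dots> = 2 * pi * (1 + real i) / (real N)\<^sup>2" by (simp add: add_divide_distrib distrib_left)
    also have "\<dots> \<le> 16 * real i / (real N)\<^sup>2"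
    proof (rule divide_right_mono)
      have "2 * pi * (1 + real i) \<le> 8 * (2 * real i)"
        using i0 pi_approx by (intro mult_mono) auto
      then show "2 * pi * (1 + real i) \<le> 16 * real i" by simp
    qed simp
    finally have t16: "?t \<le> 16 * real i / (real N)\<^sup>2" .
    have "real i \<le> 16 * (real q)\<^sup>2" using i(2) by (metis less_imp_le of_nat_le_iff of_nat_mult of_nat_numeral of_nat_power)
    then have "16 * real i \<le> (real N)\<^sup>2" by (simp add: Nq power_mult_distrib)
    then have "16 * real i / (real N)\<^sup>2 \<le> 1" using N2 by simp
    with t16 have t1: "?t \<le> 1" by linarith
    have "1 / real N = 1 * real N / (real N)\<^sup>2" using N by (simp add: power2_eq_square)
    also have "\<dots> \<le> 2 * pi * real i / (real N)\<^sup>2"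
      using i pi_gt3 by (intro divide_right_mono mult_mono) auto
    finally have t0: "1 / real N \<le> ?t" using p by linarith
    have tpos: "0 < ?t" using t0 N by (auto intro: less_le_trans[of 0 "1 / real N"])
    have "1 / (4 * (16 * real i / (real N)\<^sup>2)) \<le> 1 / (4 * ?t)"
      using t16 tpos by (intro divide_left_mono mult_pos_pos) auto
    also have "\<dots> \<le> Im (c (p + i))" by (rule Im_c_ge[OF p(4) t0 t1])
    finally show ?thesis by simp
  qed
  have Nq2: "N \<le> 16 * q\<^sup>2" unfolding Nq using q by (simp add: power2_eq_square)
  have ph: "phase (p + b) - phase (p + a) = (\<Sum>i=a..<b. \<delta>\<^sup>2 * Im (c (p + i)))" if "a \<le> b" for a b
  proof -
    have "phase (p + b) - phase (p + a) = (\<Sum>j=p+a..<p+b. \<delta>\<^sup>2 * Im (c j))"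
      unfolding phase_def lessThan_atLeast0 using that by (subst sum_diff_nat_ivl) auto
    then show ?thesis
      using sum.shift_bounds_nat_ivl[of "\<lambda>j. \<delta>\<^sup>2 * Im (c j)" a p b] by (simp add: add.commute)
  qed
  define P where "P n \<longleftrightarrow> N \<le> n \<and> pi / 3 \<le> phase (p + n) - phase (p + N)" for n
  have top: "P (16 * q\<^sup>2)"
  proof -
    have "ln (real (16 * q\<^sup>2)) - ln (real N) = (\<Sum>i=N..<16 * q\<^sup>2. ln (real (Suc i)) - ln (real i))"
      using sum_Suc_diff'[OF Nq2, of "\<lambda>i. ln (real i)"] by simp
    also have "\<dots> \<le> (\<Sum>i=N..<16 * q\<^sup>2. 1 / real i)"
    proof (rule sum_mono)
      fix i assume "i \<in> {N..<16 * q\<^sup>2}"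
      then have i: "0 < real i" using N by auto
      then have "1 + 1 / real i = real (Suc i) / real i" by (simp add: field_simps)
      then have "ln (real (Suc i)) - ln (real i) = ln (1 + 1 / real i)"
        using i by (simp add: ln_div del: of_nat_Suc)
      also have "\<dots> \<le> 1 / real i" using i by (intro ln_add_one_self_le_self) auto
      finally show "ln (real (Suc i)) - ln (real i) \<le> 1 / real i" .
    qed
    finally have s: "ln (real q) \<le> (\<Sum>i=N..<16 * q\<^sup>2. 1 / real i)"
      using q by (simp add: Nq ln_mult ln_realpow)
    have "2 \<le> eps\<^sup>2 / 64 * ln (real q)" using ln_q by simp
    also have "\<dots> \<le> eps\<^sup>2 / 64 * (\<Sum>i=N..<16 * q\<^sup>2. 1 / real i)"
      using s by (intro mult_left_mono) auto
    also have "\<dots> = (\<Sum>i=N..<16 * q\<^sup>2. \<delta>\<^sup>2 * ((real N)\<^sup>2 / (64 * real i)))"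
      unfolding sum_distrib_left using N by (simp add: \<delta>_def power_divide)
    also have "\<dots> \<le> (\<Sum>i=N..<16 * q\<^sup>2. \<delta>\<^sup>2 * Im (c (p + i)))"
      using Im by (intro sum_mono mult_left_mono) auto
    also have "\<dots> = phase (p + 16 * q\<^sup>2) - phase (p + N)" using ph[OF Nq2] by simp
    finally show ?thesis using Nq2 pi_less_4 by (simp add: P_def)
  qed
  \<comment> \<open>Stopping at the first time the gain reaches pi/3 keeps it below pi, because a
    single step adds at most 1.\<close>
  define n where "n = (LEAST n. P n)"
  have Pn: "P n" unfolding n_def using top by (rule LeastI)
  have n_le: "n \<le> 16 * q\<^sup>2" unfolding n_def using top by (rule Least_le)
  have "n \<noteq> N" using Pn pi_gt3 by (auto simp: P_def)
  then have nN: "N \<le> n - 1" "Suc (n - 1) = n" using Pn by (auto simp: P_def)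
  have "\<not> P (n - 1)" unfolding n_def by (rule not_less_Least) (use nN in \<open>auto simp: n_def\<close>)
  then have before: "phase (p + (n - 1)) - phase (p + N) < pi / 3" using nN by (simp add: P_def)
  have "phase (p + n) - phase (p + (n - 1)) = \<delta>\<^sup>2 * Im (c (p + (n - 1)))"
    using ph[of "n - 1" n] nN by (metis (no_types, lifting) atLeastLessThan_singleton diff_le_self finite.emptyI sum.empty sum.insert empty_iff add.right_neutral)
  also have "\<dots> \<le> \<delta>\<^sup>2 * (real N / 2)"
    using abs_Im_le_cmod[of "c (p + (n - 1))"] norm_c_le[of "p + (n - 1)"] by (intro mult_left_mono) auto
  also have "\<dots> = eps * eps / (2 * real N)" using N by (simp add: \<delta>_def power2_eq_square)
  also have "\<dots> \<le> 1"
    using eps N mult_mono[of eps 1 eps 1] by (simp add: divide_le_eq)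
  finally have stp: "phase (p + n) - phase (p + (n - 1)) \<le> 1" .
  show ?thesis
  proof
    show "p + N \<le> p + n" using nN by simp
    have "16 * q\<^sup>2 \<le> N\<^sup>2" by (simp add: Nq power_mult_distrib)
    then show "p + n \<le> 2 * N\<^sup>2" using n_le p(1) by linarith
    show "pi / 3 \<le> phase (p + n) - phase (p + N)" using Pn by (simp add: P_def)
    show "phase (p + n) - phase (p + N) \<le> pi" using stp before pi_gt3 by linarith
  qed
qed

end

section \<open>Orthogonal polynomials with given recurrence coefficients\<close>

text \<open>The Szego recursion with Verblunsky coefficients \<alpha>. The reversed polynomials get
  their own simultaneous recursion instead of \<open>pstar\<close>; \<open>rev_op_circle\<close>
  identifies them with the reversals on the circle.\<close>

fun monic_op rev_op :: "(nat \<Rightarrow> complex) \<Rightarrow> nat \<Rightarrow> complex poly" where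
  "monic_op \<alpha> 0 = 1"
| "monic_op \<alpha> (Suc n) = pCons 0 (monic_op \<alpha> n) - smult (cnj (\<alpha> n)) (rev_op \<alpha> n)"
| "rev_op \<alpha> 0 = 1"
| "rev_op \<alpha> (Suc n) = rev_op \<alpha> n - smult (\<alpha> n) (pCons 0 (monic_op \<alpha> n))"

lemma coeff_op_beyond:
  "(\<forall>i>n. coeff (monic_op \<alpha> n) i = 0) \<and> (\<forall>i>n. coeff (rev_op \<alpha> n) i = 0) \<and> coeff (monic_op \<alpha> n) n = 1"
  by (induction n) (auto simp: coeff_pCons coeff_1 split: nat.splits)

lemma degree_monic_op [simp]: "degree (monic_op \<alpha> n) = n"
proof (rule antisym)
  show "degree (monic_op \<alpha> n) \<le> n" using coeff_op_beyond[of n \<alpha>] by (intro degree_le) auto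
  show "n \<le> degree (monic_op \<alpha> n)" using coeff_op_beyond[of n \<alpha>] by (intro le_degree) simp
qed

lemma coeff_monic_op [simp]: "coeff (monic_op \<alpha> n) n = 1"
  using coeff_op_beyond[of n \<alpha>] by simp

lemma poly_rev_op_0 [simp]: "poly (rev_op \<alpha> n) 0 = 1"
  by (induction n) auto

lemma unit_cnj: "norm z = 1 \<Longrightarrow> z * cnj z = 1" for z :: complex
  using complex_norm_square[of z] by simp

lemma unit_cnj_power: "norm z = 1 \<Longrightarrow> z ^ n * cnj z ^ n = 1" for z :: complex
  by (simp add: unit_cnj flip: power_mult_distrib)

lemma rev_op_circle:
  assumes z: "norm z = 1"
  shows "poly (rev_op \<alpha> n) z = z ^ n * cnj (poly (monic_op \<alpha> n) z)"
proof (induction n)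
  case (Suc n)
  let ?M = "poly (monic_op \<alpha> n) z"
  have zz: "z * cnj z = 1" "z ^ n * cnj z ^ n = 1" using unit_cnj unit_cnj_power z by auto
  have "z ^ Suc n * cnj (poly (monic_op \<alpha> (Suc n)) z)
      = (z * cnj z) * (z ^ n * cnj ?M) - \<alpha> n * z * (z ^ n * cnj z ^ n) * ?M"
    by (simp add: Suc algebra_simps)
  also have "\<dots> = poly (rev_op \<alpha> (Suc n)) z" by (simp add: zz Suc algebra_simps)
  finally show ?case by simp
qed simp

lemma monic_op_circle:
  assumes z: "norm z = 1"
  shows "poly (monic_op \<alpha> n) z = z ^ n * cnj (poly (rev_op \<alpha> n) z)"
  using unit_cnj_power[OF z, of n] by (simp add: rev_op_circle[OF z] flip: mult.assoc)

lemma rev_op_Suc_circle: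
  assumes z: "norm z = 1"
  shows "poly (rev_op \<alpha> (Suc n)) z = poly (rev_op \<alpha> n) z - \<alpha> n * z ^ Suc n * cnj (poly (rev_op \<alpha> n) z)"
  by (simp add: monic_op_circle[OF z])

text \<open>The two claims need each other: domination of the monic polynomial excludes a zero in
  the next step, and the identity |q - a p|^2 - |p - cnj a q|^2 = (1 - |a|^2)(|q|^2 - |p|^2) hands
  the domination on. Absence of zeros makes 1/\<open>rev_op\<close> holomorphic in the disc.\<close>

lemma rev_op_disc:
  assumes \<alpha>: "\<And>n. norm (\<alpha> n) < 1" and z: "norm z \<le> 1"
  shows "poly (rev_op \<alpha> n) z \<noteq> 0 \<and> norm (poly (monic_op \<alpha> n) z) \<le> norm (poly (rev_op \<alpha> n) z)"
proof (induction n)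
  case (Suc n)
  define a p q where "a = \<alpha> n" and "p = z * poly (monic_op \<alpha> n) z" and "q = poly (rev_op \<alpha> n) z"
  have q: "q \<noteq> 0" using Suc by (simp add: q_def)
  have pq: "norm p \<le> norm q"
    using Suc z by (auto simp: p_def q_def norm_mult intro: order_trans[OF mult_left_le_one_le])
  have a: "norm a < 1" using \<alpha> by (simp add: a_def)
  have "q - a * p \<noteq> 0"
  proof
    assume "q - a * p = 0"
    then have "norm q = norm a * norm p" by (simp add: norm_mult[symmetric])
    also have "\<dots> \<le> norm a * norm q" using pq by (intro mult_left_mono) auto
    also have "\<dots> < 1 * norm q" using a q by (intro mult_strict_right_mono) auto
    finally show False by simp
  qed
  moreover have "(norm (p - cnj a * q))\<^sup>2 \<le> (norm (q - a * p))\<^sup>2"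
  proof -
    have "(norm (q - a * p))\<^sup>2 - (norm (p - cnj a * q))\<^sup>2 = (1 - (norm a)\<^sup>2) * ((norm q)\<^sup>2 - (norm p)\<^sup>2)"
      unfolding cmod_power2 by (simp add: power2_eq_square algebra_simps)
    moreover have "0 \<le> (1 - (norm a)\<^sup>2) * ((norm q)\<^sup>2 - (norm p)\<^sup>2)"
      using a pq by (intro mult_nonneg_nonneg) (auto simp: power_mono abs_square_le_1)
    ultimately show ?thesis by linarith
  qed
  ultimately show ?case
    by (auto simp: a_def p_def q_def algebra_simps intro: power2_le_imp_le)
qed simp

section \<open>Integration over the circle\<close>

lemma sets_circle_m [simp, measurable_cong]: "sets circle_m = sets borel"
  by (simp add: circle_m_def)

lemma space_circle_m [simp]: "space circle_m = UNIV"
  by (simp add: circle_m_def)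

lemma measurable_cis [measurable]: "cis \<in> borel_measurable borel"
  by (intro borel_measurable_continuous_onI continuous_intros)

lemma prob_space_circle_m: "prob_space circle_m"
  unfolding circle_m_def
  by (intro prob_space.prob_space_distr prob_space_uniform_measure) auto

interpretation circle_m: prob_space circle_m by (rule prob_space_circle_m)

lemma AE_circle_m: "AE z in circle_m. norm z = 1"
  unfolding circle_m_def by (subst AE_distr_iff) auto

lemma integrable_concentrated_on_circle:
  fixes f :: "complex \<Rightarrow> complex"
  assumes "prob_space M" and [measurable_cong]: "sets M = sets borel" and AE: "AE z in M. norm z = 1"
    and [measurable]: "f \<in> borel_measurable borel" and cont: "continuous_on circle f"
  shows "integrable M f"
proof -
  interpret prob_space M by fact
  have "bounded (f ` circle)"
    by (intro compact_imp_bounded compact_continuous_image cont compact_sphere)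
  then obtain B where "\<forall>z\<in>circle. norm (f z) \<le> B" by (auto simp: bounded_iff)
  then show ?thesis
    using AE by (intro integrable_const_bound[where B = B]) (auto elim!: eventually_mono)
qed

lemmas integrable_circle_m =
  integrable_concentrated_on_circle[OF prob_space_circle_m sets_circle_m AE_circle_m]

lemma integral_circle_m:
  fixes f :: "complex \<Rightarrow> complex"
  assumes [measurable]: "f \<in> borel_measurable borel"
  shows "(\<integral>z. f z \<partial>circle_m) = (LINT t:{0..2*pi}|lborel. f (cis t)) / (2 * pi)"
proof -
  have d: "uniform_measure lborel {0..2*pi} = density lborel (\<lambda>t. ennreal (indicator {0..2*pi} t / (2*pi)))"
    unfolding uniform_measure_def
    by (intro arg_cong[where f = "density lborel"] ext) (auto simp: divide_ennreal ennreal_1[symmetric] simp del: ennreal_1 split: split_indicator)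
  have "(\<integral>z. f z \<partial>circle_m) = (\<integral>t. f (cis t) \<partial>uniform_measure lborel {0..2*pi})"
    unfolding circle_m_def by (rule integral_distr) auto
  also have "\<dots> = (\<integral>t. (indicator {0..2*pi} t / (2*pi)) *\<^sub>R f (cis t) \<partial>lborel)"
    unfolding d by (rule integral_density) auto
  also have "\<dots> = (\<integral>t. (1 / (2*pi)) *\<^sub>R (indicator {0..2*pi} t *\<^sub>R f (cis t)) \<partial>lborel)"
    by simp
  also have "\<dots> = (LINT t:{0..2*pi}|lborel. f (cis t)) / (2 * pi)"
    unfolding set_lebesgue_integral_def integral_scaleR_right by (simp add: scaleR_conv_of_real)
  finally show ?thesis .
qed

lemma mean_value_circle_m:
  fixes f :: "complex \<Rightarrow> complex"
  assumes [measurable]: "f \<in> borel_measurable borel"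
    and cont: "continuous_on (cball 0 1) f" and holo: "f holomorphic_on ball 0 1"
  shows "(\<integral>z. f z \<partial>circle_m) = f 0"
proof -
  have "((\<lambda>w. f w / (w - 0)) has_contour_integral (2 * of_real pi * \<i> * f 0)) (part_circlepath 0 1 0 (2*pi))"
    using Cauchy_integral_circlepath[OF cont holo, of 0] by (simp add: circlepath_def)
  then have "((\<lambda>t. f (cis t) * \<i>) has_integral (2 * of_real pi * \<i> * f 0)) {0..2*pi}"
    by (subst (asm) has_contour_integral_part_circlepath_iff) (auto simp: cis_neq_zero)
  \<comment> \<open>On the unit circle dw/w = i dt; multiplying by -i removes this factor.\<close>
  then have "((\<lambda>t. f (cis t) * \<i> * (-\<i>)) has_integral (2 * of_real pi * \<i> * f 0 * (-\<i>))) {0..2*pi}"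
    by (rule has_integral_mult_left)
  then have hk: "((\<lambda>t. f (cis t)) has_integral (2 * of_real pi * f 0)) {0..2*pi}"
    by (simp add: mult_ac)
  have "continuous_on {0..2*pi} (\<lambda>t. f (cis t))"
    by (intro continuous_on_compose2[OF cont] continuous_intros) auto
  then have "set_integrable lborel {0..2*pi} (\<lambda>t. f (cis t))"
    by (rule borel_integrable_atLeastAtMost')
  then have "(LINT t:{0..2*pi}|lborel. f (cis t)) = 2 * of_real pi * f 0"
    using hk set_borel_integral_eq_integral(2) integral_unique by metis
  then show ?thesis by (simp add: integral_circle_m)
qed

lemma measurable_poly [measurable]: "poly p \<in> borel_measurable borel" for p :: "complex poly"
  by (intro borel_measurable_continuous_onI continuous_intros)

lemma measurable_cnj [measurable]: "cnj \<in> borel_measurable borel"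
  by (intro borel_measurable_continuous_onI continuous_intros)

section \<open>Bernstein-Szego weights\<close>

definition gap :: "(nat \<Rightarrow> complex) \<Rightarrow> nat \<Rightarrow> real" where
  "gap \<alpha> n = 1 - (norm (\<alpha> n))\<^sup>2"

definition monic_norm2 :: "(nat \<Rightarrow> complex) \<Rightarrow> nat \<Rightarrow> real" where
  "monic_norm2 \<alpha> n = (\<Prod>j<n. gap \<alpha> j)"

context
  fixes \<alpha> :: "nat \<Rightarrow> complex"
  assumes \<alpha>: "\<And>n. norm (\<alpha> n) < 1"
begin

lemma gap_pos: "0 < gap \<alpha> n"
  using \<alpha>[of n] by (simp add: gap_def abs_square_less_1)

lemma monic_norm2_pos: "0 < monic_norm2 \<alpha> n"
  unfolding monic_norm2_def using gap_pos by (intro prod_pos) auto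

lemma decseq_monic_norm2: "decseq (monic_norm2 \<alpha>)"
proof (rule decseq_SucI)
  fix n
  have "monic_norm2 \<alpha> (Suc n) = monic_norm2 \<alpha> n * gap \<alpha> n" by (simp add: monic_norm2_def)
  also have "\<dots> \<le> monic_norm2 \<alpha> n" using monic_norm2_pos[of n] by (intro mult_left_le) (auto simp: gap_def)
  finally show "monic_norm2 \<alpha> (Suc n) \<le> monic_norm2 \<alpha> n" .
qed

lemma integrable_bernstein_szego:
  fixes f :: "complex \<Rightarrow> complex"
  assumes [measurable]: "f \<in> borel_measurable borel" and f: "continuous_on circle f"
  shows "integrable circle_m (\<lambda>z. f z / of_real ((norm (poly (rev_op \<alpha> N) z))\<^sup>2))"
proof (rule integrable_circle_m)
  show "continuous_on circle (\<lambda>z. f z / of_real ((norm (poly (rev_op \<alpha> N) z))\<^sup>2))"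
    using rev_op_disc[OF \<alpha>] by (intro continuous_intros f) auto
qed measurable

text \<open>On the circle the integrand equals z^(N-k) / \<open>rev_op\<close>, which is holomorphic
  in the disc. The mean value property evaluates it at 0, where \<open>rev_op\<close> is 1.\<close>

lemma bernstein_szego_top:
  assumes "k \<le> N"
  shows "(\<integral>z. poly (monic_op \<alpha> N) z * cnj z ^ k / of_real ((norm (poly (rev_op \<alpha> N) z))\<^sup>2) \<partial>circle_m)
      = (if k = N then 1 else 0)"
proof -
  let ?R = "\<lambda>z. poly (rev_op \<alpha> N) z"
  have nz: "?R z \<noteq> 0" if "norm z \<le> 1" for z using rev_op_disc[of \<alpha> z N] \<alpha> that by blast
  have "(\<integral>z. poly (monic_op \<alpha> N) z * cnj z ^ k / of_real ((norm (?R z))\<^sup>2) \<partial>circle_m)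
      = (\<integral>z. z ^ (N - k) / ?R z \<partial>circle_m)"
  proof (rule integral_cong_AE)
    show "AE z in circle_m. poly (monic_op \<alpha> N) z * cnj z ^ k / of_real ((norm (?R z))\<^sup>2) = z ^ (N - k) / ?R z"
      using AE_circle_m
    proof eventually_elim
      case (elim z)
      have "z ^ N * cnj z ^ k = z ^ (N - k) * (z ^ k * cnj z ^ k)"
        using assms by (simp flip: power_add mult.assoc)
      then have zN: "z ^ N * cnj z ^ k = z ^ (N - k)" using unit_cnj_power[OF elim] by simp
      have "poly (monic_op \<alpha> N) z * cnj z ^ k = (z ^ N * cnj z ^ k) * cnj (?R z)"
        by (simp add: monic_op_circle[OF elim])
      moreover have "of_real ((norm (?R z))\<^sup>2) = ?R z * cnj (?R z)" by (rule complex_norm_square)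
      ultimately show ?case using nz[of z] elim by (simp only: zN) (simp add: field_simps)
    qed
  qed measurable
  also have "\<dots> = 0 ^ (N - k) / ?R 0"
    using nz by (intro mean_value_circle_m holomorphic_intros continuous_intros) auto
  finally show ?thesis using assms by auto
qed

text \<open>Downward induction on the degree with the weight of index N fixed, using the inverse
  Szego recursion. The weight is not normalised: for n = k = 0 its total mass is 1 /
  \<open>monic_norm2 \<alpha> N\<close>.\<close>

lemma bernstein_szego:
  assumes "n \<le> N" "k \<le> n"
  shows "(\<integral>z. poly (monic_op \<alpha> n) z * cnj z ^ k / of_real ((norm (poly (rev_op \<alpha> N) z))\<^sup>2) \<partial>circle_m)
      = (if k = n then of_real (monic_norm2 \<alpha> n / monic_norm2 \<alpha> N) else 0)"
  using assms
proof (induction n arbitrary: k rule: inc_induct)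
  case base
  then show ?case using bernstein_szego_top monic_norm2_pos[of N] by simp
next
  case (step n)
  let ?W = "\<lambda>z. complex_of_real ((norm (poly (rev_op \<alpha> N) z))\<^sup>2)"
  define J where "J n k = (\<integral>z. poly (monic_op \<alpha> n) z * cnj z ^ k / ?W z \<partial>circle_m)" for n k
  have IH: "J (Suc n) j = (if j = Suc n then of_real (monic_norm2 \<alpha> (Suc n) / monic_norm2 \<alpha> N) else 0)" if "j \<le> Suc n" for j
    using step.IH[OF that] unfolding J_def .
  \<comment> \<open>Reversal turns the moment of order k + 1 of the reversed polynomial into the
    conjugate of a moment of the monic one, to which the induction hypothesis applies.\<close>
  have rev: "(\<integral>z. poly (rev_op \<alpha> (Suc n)) z * cnj z ^ Suc k / ?W z \<partial>circle_m) = cnj (J (Suc n) (n - k))"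
    unfolding J_def Bochner_Integration.integral_cnj[symmetric]
  proof (rule integral_cong_AE)
    show "AE z in circle_m. poly (rev_op \<alpha> (Suc n)) z * cnj z ^ Suc k / ?W z
       = cnj (poly (monic_op \<alpha> (Suc n)) z * cnj z ^ (n - k) / ?W z)"
      using AE_circle_m
    proof eventually_elim
      case (elim z)
      have "z ^ Suc n * cnj z ^ Suc k = z ^ (n - k) * (z ^ Suc k * cnj z ^ Suc k)"
        using step.prems by (simp flip: power_add mult.assoc del: power_Suc)
      also have "\<dots> = z ^ (n - k)" unfolding unit_cnj_power[OF elim] by simp
      finally show ?case
        unfolding rev_op_circle[OF elim] by (simp del: power_Suc monic_op.simps)
    qed
  qed measurable
  have int: "integrable circle_m (\<lambda>z. poly p z * cnj z ^ j / ?W z)" for p j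
    by (intro integrable_bernstein_szego continuous_intros) measurable
  have "of_real (gap \<alpha> n) * J n k
      = (\<integral>z. of_real (gap \<alpha> n) * (poly (monic_op \<alpha> n) z * cnj z ^ k / ?W z) \<partial>circle_m)"
    unfolding J_def integral_mult_right_zero ..
  \<comment> \<open>Inverse recursion: (1 - |\<alpha>|^2) z times the monic polynomial of degree n
    is the next monic polynomial plus cnj \<alpha> times the next reversed one. The factor z is
    absorbed by the extra power of cnj z.\<close>
  also have "\<dots> = (\<integral>z. poly (monic_op \<alpha> (Suc n)) z * cnj z ^ Suc k / ?W z
         + cnj (\<alpha> n) * (poly (rev_op \<alpha> (Suc n)) z * cnj z ^ Suc k / ?W z) \<partial>circle_m)"
  proof (rule integral_cong_AE)
    show "AE z in circle_m. of_real (gap \<alpha> n) * (poly (monic_op \<alpha> n) z * cnj z ^ k / ?W z)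
       = poly (monic_op \<alpha> (Suc n)) z * cnj z ^ Suc k / ?W z + cnj (\<alpha> n) * (poly (rev_op \<alpha> (Suc n)) z * cnj z ^ Suc k / ?W z)"
      using AE_circle_m
    proof eventually_elim
      case (elim z)
      have g: "of_real (gap \<alpha> n) = 1 - \<alpha> n * cnj (\<alpha> n)"
        unfolding gap_def of_real_diff complex_norm_square by simp
      have "poly (monic_op \<alpha> (Suc n)) z * cnj z ^ Suc k + cnj (\<alpha> n) * (poly (rev_op \<alpha> (Suc n)) z * cnj z ^ Suc k)
          = (1 - \<alpha> n * cnj (\<alpha> n)) * (poly (monic_op \<alpha> n) z * cnj z ^ k) * (z * cnj z)"
        by (simp add: algebra_simps)
      then show ?case unfolding g unit_cnj[OF elim]
        by (metis (no_types, lifting) add_divide_distrib mult.right_neutral times_divide_eq_right)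
    qed
  qed measurable
  also have "\<dots> = J (Suc n) (Suc k) + cnj (\<alpha> n) * cnj (J (Suc n) (n - k))"
    unfolding rev[symmetric] integral_mult_right_zero[symmetric] unfolding J_def
    by (intro Bochner_Integration.integral_add integrable_mult_right int)
  \<comment> \<open>Here n - k is less than n + 1, so the conjugated term vanishes, and the first
    term survives only for k = n.\<close>
  also have "\<dots> = (if k = n then of_real (monic_norm2 \<alpha> (Suc n) / monic_norm2 \<alpha> N) else 0)"
    using step.prems IH[of "Suc k"] IH[of "n - k"] by auto
  finally have "of_real (gap \<alpha> n) * J n k = (if k = n then of_real (monic_norm2 \<alpha> (Suc n) / monic_norm2 \<alpha> N) else 0)" .
  moreover have "monic_norm2 \<alpha> (Suc n) = gap \<alpha> n * monic_norm2 \<alpha> n"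
    by (simp add: monic_norm2_def)
  ultimately have "of_real (gap \<alpha> n) * J n k
      = of_real (gap \<alpha> n) * (if k = n then of_real (monic_norm2 \<alpha> n / monic_norm2 \<alpha> N) else 0)"
    by simp
  then have "J n k = (if k = n then of_real (monic_norm2 \<alpha> n / monic_norm2 \<alpha> N) else 0)"
    using gap_pos[of n] by (subst (asm) mult_left_cancel) auto
  then show ?case by (simp add: J_def)
qed

end

section \<open>Uniqueness of orthonormal polynomials\<close>

text \<open>Vanishing coefficients from m on replace a degree bound, so that m = 0 correctly forces
  p = 0 and the induction can start there.\<close>

lemma triangular_span:
  fixes \<phi> :: "nat \<Rightarrow> 'a::field poly"
  assumes \<phi>: "\<And>n. degree (\<phi> n) = n" "\<And>n. \<phi> n \<noteq> 0" and p: "\<And>i. m \<le> i \<Longrightarrow> coeff p i = 0"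
  shows "\<exists>c. p = (\<Sum>j<m. smult (c j) (\<phi> j))"
  using p
proof (induction m arbitrary: p)
  case 0
  then show ?case by (simp add: poly_eq_iff)
next
  case (Suc m)
  define a where "a = coeff p m / coeff (\<phi> m) m"
  have lc: "coeff (\<phi> m) m \<noteq> 0" using \<phi>[of m] by (metis leading_coeff_0_iff)
  have "coeff (p - smult a (\<phi> m)) i = 0" if "m \<le> i" for i
  proof (cases "i = m")
    case False
    then have "coeff (\<phi> m) i = 0" using that \<phi>(1)[of m] by (intro coeff_eq_0) auto
    then show ?thesis using Suc.prems[of i] that False by simp
  qed (use lc in \<open>simp add: a_def\<close>)
  then obtain c where "p - smult a (\<phi> m) = (\<Sum>j<m. smult (c j) (\<phi> j))" using Suc.IH by blast
  then have "p = (\<Sum>j<m. smult (c j) (\<phi> j)) + smult a (\<phi> m)" by (simp add: algebra_simps)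
  also have "\<dots> = (\<Sum>j<Suc m. smult ((c(m := a)) j) (\<phi> j))" by simp
  finally show ?case by blast
qed

context
  fixes \<sigma> :: "complex measure"
begin

definition ip :: "complex poly \<Rightarrow> complex poly \<Rightarrow> complex" where
  "ip p q = (\<integral>z. poly p z * cnj (poly q z) \<partial>\<sigma>)"

lemma ip_smult_left: "ip (smult a p) r = a * ip p r"
  by (simp add: ip_def mult.assoc)

lemma ip_commute: "ip p q = cnj (ip q p)"
  by (simp add: ip_def mult.commute flip: Bochner_Integration.integral_cnj)

lemma ip_smult_right: "ip p (smult a q) = cnj a * ip p q"
  by (subst (1 2) ip_commute) (simp add: ip_smult_left)

context
  assumes \<sigma>: "prob_on_circle \<sigma>"
begin

lemma sets_prob_on_circle: "sets \<sigma> = sets borel"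
  using \<sigma> by (simp add: prob_on_circle_def)

lemma AE_prob_on_circle: "AE z in \<sigma>. norm z = 1"
proof -
  have sp: "space \<sigma> = UNIV" using sets_eq_imp_space_eq[OF sets_prob_on_circle] by simp
  have "emeasure \<sigma> (UNIV - circle) = 0" using \<sigma> by (simp add: prob_on_circle_def)
  then show ?thesis
    by (intro AE_I'[of "UNIV - circle"]) (auto simp: null_sets_def sets_prob_on_circle sp)
qed

lemma integrable_ip: "integrable \<sigma> (\<lambda>z. poly p z * cnj (poly q z))"
  using \<sigma>
  by (intro integrable_concentrated_on_circle[OF _ sets_prob_on_circle AE_prob_on_circle] continuous_intros)
    (auto simp: prob_on_circle_def)

lemma ip_add_left: "ip (p + q) r = ip p r + ip q r"
  using integrable_ip[of p r] integrable_ip[of q r] by (simp add: ip_def distrib_right)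

lemma ip_sum_left: "ip (\<Sum>i\<in>A. f i) r = (\<Sum>i\<in>A. ip (f i) r)"
proof (cases "finite A")
  case True
  then show ?thesis by (induction A) (auto simp: ip_add_left, simp_all add: ip_def)
qed (simp add: ip_def)

lemma ip_sum_right: "ip r (\<Sum>i\<in>A. f i) = (\<Sum>i\<in>A. ip r (f i))"
  by (subst ip_commute, subst ip_sum_left, subst (2) ip_commute) simp

text \<open>Subtracting from \<psi> the multiple of \<phi> with the same leading coefficient leaves
  a polynomial of lower degree that is orthogonal to all earlier \<phi>, hence 0. Normalisation and
  positive leading coefficients then force the multiple to be 1.\<close>

lemma is_ONP_unique:
  assumes \<phi>: "is_ONP \<sigma> \<phi>" and \<psi>: "is_ONP \<sigma> \<psi>"
  shows "\<phi> = \<psi>"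
proof
  fix n
  have on: "ip (f i) (f j) = (if i = j then 1 else 0)" if "is_ONP \<sigma> f" for f i j
    using that by (simp add: is_ONP_def ip_def)
  have deg: "degree (f i) = i" "f i \<noteq> 0" and lc: "\<exists>r>0. coeff (f i) i = of_real r" if f: "is_ONP \<sigma> f" for f i
  proof -
    show d: "degree (f i) = i" using f by (simp add: is_ONP_def)
    have "lead_coeff (f i) \<in> \<real>" "Re (lead_coeff (f i)) > 0" using f unfolding is_ONP_def by blast+
    then show "\<exists>r>0. coeff (f i) i = of_real r" by (metis d of_real_Re)
    then show "f i \<noteq> 0" by auto
  qed
  have low: "ip (f n) p = 0" if f: "is_ONP \<sigma> f" and p: "\<And>i. n \<le> i \<Longrightarrow> coeff p i = 0" for f p
  proof -
    obtain c where "p = (\<Sum>j<n. smult (c j) (f j))"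
      using triangular_span[OF deg(1)[OF f] deg(2)[OF f] p] by blast
    then show ?thesis by (simp add: ip_sum_right ip_smult_right on[OF f])
  qed
  obtain r s where r: "r > 0" "coeff (\<phi> n) n = of_real r" and s: "s > 0" "coeff (\<psi> n) n = of_real s"
    using lc[OF \<phi>, of n] lc[OF \<psi>, of n] by blast
  define d where "d = \<psi> n - smult (of_real (s / r)) (\<phi> n)"
  have dn: "coeff d i = 0" if "n \<le> i" for i
  proof (cases "i = n")
    case False
    then have "coeff (\<phi> n) i = 0" "coeff (\<psi> n) i = 0" using that deg(1)[OF \<phi>] deg(1)[OF \<psi>] by (auto intro!: coeff_eq_0)
    then show ?thesis by (simp add: d_def)
  qed (use r s in \<open>simp add: d_def\<close>)
  obtain c where c: "d = (\<Sum>j<n. smult (c j) (\<phi> j))"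
    using triangular_span[OF deg(1)[OF \<phi>] deg(2)[OF \<phi>] dn] by blast
  have "c j = 0" if "j < n" for j
  proof -
    have phi_j: "ip (f n) (\<phi> j) = 0" if f: "is_ONP \<sigma> f" for f
      by (rule low[OF f]) (use \<open>j < n\<close> deg(1)[OF \<phi>] in \<open>auto intro!: coeff_eq_0\<close>)
    have "ip d (\<phi> j) = ip (\<psi> n) (\<phi> j) + - of_real (s / r) * ip (\<phi> n) (\<phi> j)"
      unfolding d_def diff_conv_add_uminus smult_minus_left[symmetric] ip_add_left ip_smult_left ..
    then have "ip d (\<phi> j) = 0" by (simp add: phi_j[OF \<phi>] phi_j[OF \<psi>])
    moreover have "ip d (\<phi> j) = (\<Sum>i<n. if i = j then c i else 0)"
      unfolding c ip_sum_left ip_smult_left on[OF \<phi>] by (intro sum.cong) auto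
    ultimately show ?thesis using that by simp
  qed
  then have "d = 0" unfolding c by simp
  then have eq: "\<psi> n = smult (of_real (s / r)) (\<phi> n)" by (simp add: d_def)
  have "1 = ip (\<psi> n) (\<psi> n)" using on[OF \<psi>] by simp
  also have "\<dots> = of_real ((s / r)\<^sup>2)"
    unfolding eq ip_smult_left ip_smult_right using on[OF \<phi>, of n n] by (simp add: power2_eq_square)
  finally have "(s / r)\<^sup>2 = 1" by (metis of_real_eq_1_iff)
  then have "s / r = 1" using r s by (simp add: power2_eq_1_iff field_simps)
  then show "\<phi> n = \<psi> n" by (simp add: eq)
qed

lemma ONP_eqI: "is_ONP \<sigma> \<phi> \<Longrightarrow> ONP \<sigma> = \<phi>"
  unfolding ONP_def using is_ONP_unique by (intro the_equality) auto

end

end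

section \<open>The limit measure and its orthonormal polynomials\<close>

text \<open>Convergence of the Bernstein-Szego weights is asked only along the indices
  \<open>S\<close>, later the block starts. The bound \<open>hi\<close> dominates the integrands,
  and \<open>lo\<close> gives the Szego condition and full support.\<close>

locale szego_limit =
  fixes \<alpha> :: "nat \<Rightarrow> complex" and S :: "nat \<Rightarrow> nat" and w :: "complex \<Rightarrow> real" and lo hi :: real
  assumes \<alpha>: "\<And>n. norm (\<alpha> n) < 1"
    and S: "filterlim S at_top sequentially"
    and w_measurable [measurable]: "w \<in> borel_measurable borel"
    and lo: "0 < lo" "\<And>z. lo \<le> w z"
    and w_lim: "\<And>z. norm z = 1 \<Longrightarrow>
      (\<lambda>k. monic_norm2 \<alpha> (S k) / (norm (poly (rev_op \<alpha> (S k)) z))\<^sup>2) \<longlonglongrightarrow> w z"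
    and hi: "\<And>z k. norm z = 1 \<Longrightarrow> monic_norm2 \<alpha> (S k) / (norm (poly (rev_op \<alpha> (S k)) z))\<^sup>2 \<le> hi"
begin

definition \<sigma> :: "complex measure" where "\<sigma> = density circle_m (\<lambda>z. ennreal (w z))"

lemma w_pos: "0 < w z"
  using lo(1) lo(2)[of z] by linarith

lemma sets_\<sigma> [simp, measurable_cong]: "sets \<sigma> = sets borel"
  by (simp add: \<sigma>_def)

lemma norm2_pos [simp]: "0 < monic_norm2 \<alpha> n"
  using monic_norm2_pos[of \<alpha>] \<alpha> by simp

lemma integral_\<sigma>:
  fixes f :: "complex \<Rightarrow> complex"
  assumes [measurable]: "f \<in> borel_measurable borel"
  shows "(\<integral>z. f z \<partial>\<sigma>) = (\<integral>z. f z * of_real (w z) \<partial>circle_m)"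
  unfolding \<sigma>_def
  by (subst integral_density) (auto simp: less_imp_le[OF w_pos] scaleR_conv_of_real mult.commute)

text \<open>Dominated convergence: once S i is at least n, the moment for the normalised weight of
  index S i already equals the claimed value, so the sequence of moments is eventually
  constant.\<close>

lemma moment_\<sigma>:
  assumes "k \<le> n"
  shows "(\<integral>z. poly (monic_op \<alpha> n) z * cnj z ^ k \<partial>\<sigma>) = (if k = n then of_real (monic_norm2 \<alpha> n) else 0)"
    (is "_ = ?v")
proof -
  let ?f = "\<lambda>z. poly (monic_op \<alpha> n) z * cnj z ^ k"
  let ?w = "\<lambda>i z. monic_norm2 \<alpha> (S i) / (norm (poly (rev_op \<alpha> (S i)) z))\<^sup>2"
  have lim: "(\<lambda>i. \<integral>z. ?f z * of_real (?w i z) \<partial>circle_m) \<longlonglongrightarrow> (\<integral>z. ?f z * of_real (w z) \<partial>circle_m)"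
  proof (rule integral_dominated_convergence[where w = "\<lambda>z. norm (?f z) * hi"])
    have "integrable circle_m ?f"
      by (intro integrable_circle_m continuous_intros) measurable
    then show "integrable circle_m (\<lambda>z. norm (?f z) * hi)" by simp
    show "AE z in circle_m. (\<lambda>i. ?f z * of_real (?w i z)) \<longlonglongrightarrow> ?f z * of_real (w z)"
      using AE_circle_m by eventually_elim (intro tendsto_intros w_lim)
    show "AE z in circle_m. norm (?f z * of_real (?w i z)) \<le> norm (?f z) * hi" for i
      using AE_circle_m
    proof eventually_elim
      case (elim z)
      have "0 \<le> ?w i z" by (intro divide_nonneg_nonneg less_imp_le[OF norm2_pos]) simp
      then have "norm (of_real (?w i z) :: complex) \<le> hi" using hi[OF elim, of i] by (simp only: norm_of_real abs_of_nonneg)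
      then show ?case unfolding norm_mult[of "?f z"] by (intro mult_left_mono) auto
    qed
  qed measurable
  have "eventually (\<lambda>i. n \<le> S i) sequentially"
    using S by (simp add: filterlim_at_top)
  then have "eventually (\<lambda>i. (\<integral>z. ?f z * of_real (?w i z) \<partial>circle_m) = ?v) sequentially"
  proof eventually_elim
    case (elim i)
    have "(\<integral>z. ?f z * of_real (?w i z) \<partial>circle_m)
        = (\<integral>z. of_real (monic_norm2 \<alpha> (S i)) * (?f z / of_real ((norm (poly (rev_op \<alpha> (S i)) z))\<^sup>2)) \<partial>circle_m)"
      by (intro Bochner_Integration.integral_cong refl) simp
    also have "\<dots> = of_real (monic_norm2 \<alpha> (S i)) * (if k = n then of_real (monic_norm2 \<alpha> n / monic_norm2 \<alpha> (S i)) else 0)"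
      unfolding integral_mult_right_zero using bernstein_szego[of \<alpha>, OF _ elim assms] \<alpha> by simp
    also have "\<dots> = ?v" using norm2_pos[of "S i"] by (simp del: norm2_pos)
    finally show ?case .
  qed
  then have "(\<lambda>i. \<integral>z. ?f z * of_real (?w i z) \<partial>circle_m) \<longlonglongrightarrow> ?v"
    by (rule tendsto_eventually)
  then have "(\<integral>z. ?f z * of_real (w z) \<partial>circle_m) = ?v" using lim LIMSEQ_unique by blast
  moreover have "(\<integral>z. ?f z \<partial>\<sigma>) = (\<integral>z. ?f z * of_real (w z) \<partial>circle_m)"
    by (rule integral_\<sigma>) measurable
  ultimately show ?thesis by simp
qed

lemma prob_on_circle_\<sigma>: "prob_on_circle \<sigma>"
proof -
  have sp: "space \<sigma> = UNIV" by (simp add: \<sigma>_def)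
  have "(\<integral>z. complex_of_real (w z) \<partial>circle_m) = 1"
    using moment_\<sigma>[of 0 0] integral_\<sigma>[of "\<lambda>_. 1"] by (simp add: monic_norm2_def)
  then have one: "(\<integral>z. w z \<partial>circle_m) = 1" by (simp only: integral_complex_of_real of_real_eq_1_iff)
  \<comment> \<open>A non-integrable function would have Bochner integral 0, not 1.\<close>
  have int: "integrable circle_m w"
    using one not_integrable_integral_eq by fastforce
  have "emeasure \<sigma> (space \<sigma>) = (\<integral>\<^sup>+z. ennreal (w z) \<partial>circle_m)"
    unfolding sp by (simp add: \<sigma>_def emeasure_density)
  also have "\<dots> = 1"
    using nn_integral_eq_integral[OF int] w_pos one by (simp add: less_imp_le)
  finally have "prob_space \<sigma>" by (rule prob_spaceI)
  moreover have "emeasure \<sigma> (UNIV - circle) = 0"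
  proof -
    have "emeasure \<sigma> (UNIV - circle) = (\<integral>\<^sup>+z. ennreal (w z) * indicator (UNIV - circle) z \<partial>circle_m)"
      by (simp add: \<sigma>_def emeasure_density)
    also have "\<dots> = (\<integral>\<^sup>+z. 0 \<partial>circle_m)"
      using AE_circle_m by (intro nn_integral_cong_AE) (auto elim!: eventually_mono)
    finally show ?thesis by simp
  qed
  ultimately show ?thesis by (simp add: prob_on_circle_def)
qed

text \<open>The measure is absolutely continuous, so the null measure is the singular part, carried
  by the empty set. Since \<open>ennreal\<close> truncates at 0, the logarithmic integral sees only
  w < 1, where w at least \<open>lo\<close> bounds it.\<close>

lemma szego_class_\<sigma>: "szego_class \<sigma>"
  unfolding szego_class_def
proof (intro exI[of _ w] exI[of _ "null_measure borel"] conjI ballI allI)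
  show "\<exists>N\<in>sets borel. emeasure circle_m N = 0 \<and> emeasure (null_measure borel) (UNIV - N) = 0"
    by (intro bexI[of _ "{}"]) auto
  show "emeasure \<sigma> A = (\<integral>\<^sup>+ z. ennreal (w z) * indicator A z \<partial>circle_m) + emeasure (null_measure borel) A"
    if "A \<in> sets borel" for A
    using that by (simp add: \<sigma>_def emeasure_density)
  have "(\<integral>\<^sup>+ z. ennreal (- ln (w z)) \<partial>circle_m) \<le> (\<integral>\<^sup>+ z. ennreal (- ln lo) \<partial>circle_m)"
    using lo w_pos by (intro nn_integral_mono ennreal_leI) auto
  also have "\<dots> < \<infinity>" using circle_m.emeasure_space_1 by (simp add: ennreal_mult_less_top)
  finally show "(\<integral>\<^sup>+ z. ennreal (- ln (w z)) \<partial>circle_m) < \<infinity>" .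
qed (auto simp: w_pos less_imp_le)

lemma infinite_msupport_\<sigma>: "infinite (msupport \<sigma>)"
proof -
  have "circle \<subseteq> msupport \<sigma>"
  proof
    fix z :: complex assume "z \<in> circle"
    then obtain t where t: "0 \<le> t" "t < 2 * pi" "z = cis t"
      using complex_unimodular_polar[of z] by (metis cis.ctr dist_0_norm mem_sphere)
    have "0 < emeasure \<sigma> (ball z r)" if r: "0 < r" for r
    proof -
      \<comment> \<open>The arc from t to t + d stays inside the parameter interval, and chords are
        no longer than arcs, so d below r keeps it in the ball.\<close>
      define d where "d = min (r / 2) (2 * pi - t)"
      have d: "0 < d" "d < r" "t + d \<le> 2 * pi" using r t by (auto simp: d_def)
      have sub: "{t..t+d} \<subseteq> {0..2*pi} \<inter> cis -` ball z r"
      proof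
        fix s assume s: "s \<in> {t..t+d}"
        then have "dist z (cis s) \<le> \<bar>t - s\<bar>" using norm_cis_diff_le[of t s] by (simp add: t dist_norm)
        then show "s \<in> {0..2*pi} \<inter> cis -` ball z r" using s d t by auto
      qed
      have "0 < ennreal d" using d by simp
      also have "\<dots> = emeasure lborel {t..t+d}" using d by simp
      also have "\<dots> \<le> emeasure lborel ({0..2*pi} \<inter> cis -` ball z r)"
        using measurable_sets[OF measurable_cis, of "ball z r"] by (intro emeasure_mono sub) auto
      finally have "0 < emeasure lborel ({0..2*pi} \<inter> cis -` ball z r) / emeasure lborel {0..2*pi}"
        by (simp add: ennreal_zero_less_divide)
      moreover have "cis -` ball z r \<in> sets lborel"
        using measurable_sets[OF measurable_cis, of "ball z r"] by simp
      ultimately have m: "0 < emeasure circle_m (ball z r)"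
        by (simp add: circle_m_def emeasure_distr)
      have "0 < ennreal lo * emeasure circle_m (ball z r)"
        using m lo by (simp add: ennreal_zero_less_mult_iff)
      also have "\<dots> = (\<integral>\<^sup>+y. ennreal lo * indicator (ball z r) y \<partial>circle_m)"
        by (simp add: nn_integral_cmult_indicator)
      also have "\<dots> \<le> (\<integral>\<^sup>+y. ennreal (w y) * indicator (ball z r) y \<partial>circle_m)"
        using lo by (intro nn_integral_mono mult_right_mono ennreal_leI) auto
      also have "\<dots> = emeasure \<sigma> (ball z r)" by (simp add: \<sigma>_def emeasure_density)
      finally show ?thesis .
    qed
    then show "z \<in> msupport \<sigma>" by (simp add: msupport_def)
  qed
  moreover have "infinite circle"
  proof
    assume "finite circle"
    then obtain a where "circle \<subseteq> {a}"
      using connected_finite_iff_sing[of circle] connected_sphere[of "0::complex" 1] by auto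
    moreover have "1 \<in> circle" "-1 \<in> circle" by auto
    ultimately have "(1::complex) = -1" by blast
    then show False by simp
  qed
  ultimately show ?thesis using finite_subset by blast
qed

definition orthonormal_op :: "nat \<Rightarrow> complex poly" where
  "orthonormal_op n = smult (of_real (1 / sqrt (monic_norm2 \<alpha> n))) (monic_op \<alpha> n)"

lemma ip_monic_op:
  assumes "degree q \<le> n"
  shows "ip \<sigma> (monic_op \<alpha> n) q = cnj (coeff q n) * of_real (monic_norm2 \<alpha> n)"
proof -
  have q: "q = (\<Sum>i\<le>n. smult (coeff q i) (monom 1 i))"
    using poly_as_sum_of_monoms'[OF assms] by (simp add: smult_monom)
  have mono: "ip \<sigma> (monic_op \<alpha> n) (monom 1 i) = (if i = n then of_real (monic_norm2 \<alpha> n) else 0)" if "i \<le> n" for i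
    using moment_\<sigma>[OF that] by (simp add: ip_def poly_monom)
  have "ip \<sigma> (monic_op \<alpha> n) q = (\<Sum>i\<le>n. cnj (coeff q i) * ip \<sigma> (monic_op \<alpha> n) (monom 1 i))"
    by (subst q) (simp add: ip_sum_right[OF prob_on_circle_\<sigma>] ip_smult_right)
  also have "\<dots> = (\<Sum>i\<le>n. if i = n then cnj (coeff q n) * of_real (monic_norm2 \<alpha> n) else 0)"
    by (intro sum.cong refl) (auto simp: mono)
  finally show ?thesis by simp
qed

lemma ip_monic_op_monic_op:
  "ip \<sigma> (monic_op \<alpha> n) (monic_op \<alpha> k) = (if n = k then of_real (monic_norm2 \<alpha> n) else 0)"
proof -
  have le: "ip \<sigma> (monic_op \<alpha> a) (monic_op \<alpha> b) = (if a = b then of_real (monic_norm2 \<alpha> a) else 0)" if "b \<le> a" for a b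
    using that ip_monic_op[of "monic_op \<alpha> b" a] by (auto simp: coeff_eq_0)
  show ?thesis
  proof (cases "k \<le> n")
    case False
    then show ?thesis using le[of n k] ip_commute[of \<sigma> "monic_op \<alpha> n"] by simp
  qed (use le in blast)
qed

lemma is_ONP_orthonormal_op: "is_ONP \<sigma> orthonormal_op"
proof -
  have p: "0 < 1 / sqrt (monic_norm2 \<alpha> n)" for n using norm2_pos by simp
  then have "complex_of_real (1 / sqrt (monic_norm2 \<alpha> n)) \<noteq> 0" for n by (metis less_irrefl of_real_eq_0_iff)
  then have deg: "degree (orthonormal_op n) = n" for n
    unfolding orthonormal_op_def degree_smult_eq by (simp only: if_False degree_monic_op)
  have lc: "lead_coeff (orthonormal_op n) = of_real (1 / sqrt (monic_norm2 \<alpha> n))" for n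
    unfolding deg by (simp add: orthonormal_op_def)
  have "ip \<sigma> (orthonormal_op n) (orthonormal_op k) = (if n = k then 1 else 0)" for n k
  proof (cases "n = k")
    case True
    have "ip \<sigma> (orthonormal_op n) (orthonormal_op n)
       = of_real (1 / sqrt (monic_norm2 \<alpha> n) * (1 / sqrt (monic_norm2 \<alpha> n)) * monic_norm2 \<alpha> n)"
      unfolding orthonormal_op_def ip_smult_left ip_smult_right ip_monic_op_monic_op
      by (simp only: complex_cnj_complex_of_real of_real_mult mult.assoc if_True simp_thms)
    also have "1 / sqrt (monic_norm2 \<alpha> n) * (1 / sqrt (monic_norm2 \<alpha> n)) * monic_norm2 \<alpha> n = 1"
      using less_imp_neq[OF norm2_pos[of n]] less_imp_le[OF norm2_pos[of n]] by simp
    finally show ?thesis using True by simp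
  qed (simp add: orthonormal_op_def ip_smult_left ip_smult_right ip_monic_op_monic_op)
  then show ?thesis
    unfolding is_ONP_def deg lc[unfolded deg] using p by (auto simp: deg lc ip_def)
qed

lemma pstar_ONP:
  assumes z: "norm z = 1"
  shows "pstar (ONP \<sigma> n) z = of_real (1 / sqrt (monic_norm2 \<alpha> n)) * poly (rev_op \<alpha> n) z"
proof -
  have "ONP \<sigma> = orthonormal_op"
    by (rule ONP_eqI[OF prob_on_circle_\<sigma> is_ONP_orthonormal_op])
  moreover have "inverse (cnj z) = z"
    using unit_cnj[OF z] by (metis inverse_unique mult.commute)
  moreover have "degree (orthonormal_op n) = n" using is_ONP_orthonormal_op by (simp add: is_ONP_def)
  ultimately show ?thesis
    by (simp add: pstar_def orthonormal_op_def rev_op_circle[OF z])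
qed

end

section \<open>Concatenating the chirps\<close>

lemma concatenation_of_blocks:
  fixes len :: "nat \<Rightarrow> nat" and f :: "nat \<Rightarrow> nat \<Rightarrow> 'a"
  assumes len: "\<And>k. 0 < len k" and S_def: "\<And>k. S k = (\<Sum>i<k. len i)"
  obtains a where "\<And>k n. n < len k \<Longrightarrow> a (S k + n) = f k n"
    and "\<And>m. \<exists>k n. n < len k \<and> m = S k + n"
proof -
  have mono: "strict_mono S" unfolding S_def strict_mono_Suc_iff using len by simp
  \<comment> \<open>The index of the block containing m: the first block that ends after m.\<close>
  define blk where "blk m = (LEAST k. m < S (Suc k))" for m
  have blk: "blk (S k + n) = k" if "n < len k" for k n
    unfolding blk_def
  proof (rule Least_equality)
    show "S k + n < S (Suc k)" using that by (simp add: S_def)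
    fix j assume "S k + n < S (Suc j)"
    then have "S k < S (Suc j)" by linarith
    then show "k \<le> j" using strict_mono_less[OF mono] by simp
  qed
  have cover: "\<exists>k n. n < len k \<and> m = S k + n" for m
  proof -
    have "m < S (Suc m)" using strict_mono_imp_increasing[OF mono, of "Suc m"] by simp
    then have up: "m < S (Suc (blk m))" unfolding blk_def by (rule LeastI)
    have low: "S (blk m) \<le> m"
    proof (cases "blk m")
      case 0
      then show ?thesis by (simp add: S_def)
    next
      case (Suc j)
      then have "\<not> m < S (Suc j)" unfolding blk_def using not_less_Least by (metis lessI)
      then show ?thesis using Suc by simp
    qed
    show ?thesis
      by (intro exI[of _ "blk m"] exI[of _ "m - S (blk m)"]) (use up low in \<open>auto simp: S_def\<close>)
  qed
  show ?thesis
    by (rule that[of "\<lambda>m. f (blk m) (m - S (blk m))"]) (use blk cover in auto)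
qed

text \<open>A geometric sequence makes the changes of modulus summable; the factor 1/10000 meets the
  bound in \<open>chirp\<close> and makes 2000 eps equal to (1/2)^k / 5.\<close>

definition block_eps :: "nat \<Rightarrow> real" where
  "block_eps k = (1/2) ^ k / 10000"

text \<open>The exponential is what the hypothesis on ln q in \<open>phase_turns\<close> demands;
  adding 2 secures q at least 2.\<close>

definition block_q :: "nat \<Rightarrow> nat" where
  "block_q k = nat \<lceil>exp (128 / (block_eps k)\<^sup>2)\<rceil> + 2"

definition block_N :: "nat \<Rightarrow> nat" where
  "block_N k = 16 * block_q k"

definition block_coeff :: "nat \<Rightarrow> nat \<Rightarrow> complex" where
  "block_coeff k n = of_real (block_eps k / real (block_N k)) * cis (pi * (real n)\<^sup>2 / real ((block_N k)\<^sup>2))"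

definition block_start :: "nat \<Rightarrow> nat" where
  "block_start k = (\<Sum>i<k. 2 * (block_N i)\<^sup>2)"

lemma block_eps: "0 < block_eps k" "block_eps k \<le> 1/10000"
  by (auto simp: block_eps_def power_le_one)

lemma block_N_pos: "1 \<le> block_N k"
  by (simp add: block_N_def block_q_def)

lemma block_q: "2 \<le> block_q k" "128 \<le> (block_eps k)\<^sup>2 * ln (real (block_q k))"
proof -
  show 2: "2 \<le> block_q k" by (simp add: block_q_def)
  have "exp (128 / (block_eps k)\<^sup>2) \<le> real (block_q k)"
    unfolding block_q_def by linarith
  then have "128 / (block_eps k)\<^sup>2 \<le> ln (real (block_q k))"
    using 2 by (simp add: ln_ge_iff)
  then show "128 \<le> (block_eps k)\<^sup>2 * ln (real (block_q k))"
    using block_eps(1)[of k] by (simp add: divide_le_eq mult.commute)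
qed

lemma norm_block_coeff: "norm (block_coeff k n) < 1"
proof -
  have "norm (block_coeff k n) = block_eps k / real (block_N k)"
    using block_eps(1)[of k] by (simp add: block_coeff_def norm_mult norm_divide)
  also have "\<dots> \<le> block_eps k / 1"
    using block_eps(1)[of k] block_N_pos[of k] by (intro divide_left_mono) auto
  finally show ?thesis using block_eps(2)[of k] by linarith
qed

text \<open>The quadratic phase has increments proportional to 2 n + 1, so the frequency is linear
  in n. The constant part pi / N^2 is absorbed into the starting point \<open>z0\<close>, together
  with the factor z gained in each step of the recursion.\<close>

lemma chirp_block:
  assumes z: "norm z = 1" and \<alpha>: "\<And>n. n < 2 * (block_N k)\<^sup>2 \<Longrightarrow> \<alpha> (s + n) = block_coeff k n"
  shows "chirp (block_eps k) (block_N k) (z * cis (pi / real ((block_N k)\<^sup>2)))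
           (\<lambda>n. block_coeff k n * z ^ Suc (s + n)) (\<lambda>n. poly (rev_op \<alpha> (s + n)) z)"
proof
  let ?N = "block_N k"
  show "norm (block_coeff k 0 * z ^ Suc (s + 0)) = block_eps k / real ?N"
    using block_eps(1)[of k] z by (simp add: block_coeff_def norm_mult norm_power norm_divide)
  show "block_coeff k (Suc n) * z ^ Suc (s + Suc n)
     = z * cis (pi / real (?N\<^sup>2)) * cis (2 * pi * real n / real (?N\<^sup>2)) * (block_coeff k n * z ^ Suc (s + n))" for n
  proof -
    have "pi * (real (Suc n))\<^sup>2 / real (?N\<^sup>2) = pi / real (?N\<^sup>2) + (2 * pi * real n / real (?N\<^sup>2) + pi * (real n)\<^sup>2 / real (?N\<^sup>2))"
      unfolding add_divide_distrib[symmetric] by (simp add: power2_eq_square algebra_simps)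
    then have "cis (pi * (real (Suc n))\<^sup>2 / real (?N\<^sup>2))
       = cis (pi / real (?N\<^sup>2)) * (cis (2 * pi * real n / real (?N\<^sup>2)) * cis (pi * (real n)\<^sup>2 / real (?N\<^sup>2)))"
      by (simp only: cis_mult)
    then show ?thesis unfolding block_coeff_def by (simp only: power_Suc add_Suc_right) (simp only: mult_ac)
  qed
  show "poly (rev_op \<alpha> (s + Suc n)) z = poly (rev_op \<alpha> (s + n)) z
      - block_coeff k n * z ^ Suc (s + n) * cnj (poly (rev_op \<alpha> (s + n)) z)" if "n < 2 * ?N\<^sup>2" for n
    using rev_op_Suc_circle[OF z, of \<alpha> "s + n"] \<alpha>[OF that] by (simp del: rev_op.simps)
qed (use block_eps block_N_pos z in \<open>auto simp: norm_mult\<close>)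

section \<open>Moduli and oscillation along the blocks\<close>

locale concatenated_chirps =
  fixes \<alpha> :: "nat \<Rightarrow> complex"
  assumes \<alpha>: "\<And>k n. n < 2 * (block_N k)\<^sup>2 \<Longrightarrow> \<alpha> (block_start k + n) = block_coeff k n"
    and \<alpha>_less_1: "\<And>n. norm (\<alpha> n) < 1"
begin

lemma filterlim_block_start: "filterlim block_start at_top sequentially"
proof (rule filterlim_subseq)
  show "strict_mono block_start"
    unfolding strict_mono_Suc_iff block_start_def using block_N_pos by (simp add: Suc_le_eq)
qed

definition block_modulus :: "complex \<Rightarrow> nat \<Rightarrow> real" where
  "block_modulus z k = norm (poly (rev_op \<alpha> (block_start k)) z)"

context
  fixes z :: complex
  assumes z: "norm z = 1"
begin

lemma block_modulus_0: "block_modulus z 0 = 1"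
  by (simp add: block_modulus_def block_start_def)

lemma block_modulus_step: "\<bar>block_modulus z (Suc k) - block_modulus z k\<bar> \<le> (1/2) ^ k / 5 * block_modulus z k"
proof -
  interpret chirp "block_eps k" "block_N k" "z * cis (pi / real ((block_N k)\<^sup>2))"
    "\<lambda>n. block_coeff k n * z ^ Suc (block_start k + n)" "\<lambda>n. poly (rev_op \<alpha> (block_start k + n)) z"
    by (rule chirp_block[OF z \<alpha>])
  have "block_start (Suc k) = block_start k + 2 * (block_N k)\<^sup>2" by (simp add: block_start_def)
  then show ?thesis
    using norm_u_close[of "2 * (block_N k)\<^sup>2"] by (simp add: block_modulus_def block_eps_def)
qed

text \<open>The relative changes sum to at most 2/5, and exp (2/5) is at most 8/5, so the modulus
  stays within 3/5 of its initial value 1.\<close>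

lemma block_modulus_bounds: "2/5 \<le> block_modulus z k" "block_modulus z k \<le> 8/5"
proof -
  let ?s = "\<Sum>j=0..<k. (1/2::real) ^ j / 5"
  have "\<bar>block_modulus z k - block_modulus z 0\<bar> \<le> (exp ?s - 1) * norm (block_modulus z 0)"
    using relative_gronwall[where x = "block_modulus z" and \<kappa> = "\<lambda>k. (1/2) ^ k / 5" and m = 0 and n = k and M = k]
      block_modulus_step by (simp add: block_modulus_0 block_modulus_def)
  moreover have "exp ?s \<le> 8/5"
  proof -
    have s: "?s \<le> 2/5" "0 \<le> ?s"
      by (auto simp: sum_divide_distrib[symmetric] sum_gp_strict atLeast0LessThan power_le_one)
    then have "exp ?s \<le> 1 + ?s + ?s\<^sup>2" by (intro exp_bound) auto
    moreover have "?s\<^sup>2 \<le> (2/5)\<^sup>2" using s by (intro power_mono)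
    ultimately show ?thesis using s(1) by (simp add: power2_eq_square)
  qed
  ultimately show "2/5 \<le> block_modulus z k" "block_modulus z k \<le> 8/5" by (auto simp: block_modulus_0)
qed

lemma convergent_block_modulus: "convergent (block_modulus z)"
proof -
  have "summable (\<lambda>k. block_modulus z (Suc k) - block_modulus z k)"
  proof (rule summable_comparison_test')
    show "summable (\<lambda>k. (8/5) * ((1/2::real) ^ k / 5))"
      by (intro summable_mult summable_divide summable_geometric) simp
    fix k
    have "(1/2) ^ k / 5 * block_modulus z k \<le> (1/2) ^ k / 5 * (8/5)" using block_modulus_bounds by (intro mult_left_mono) auto
    then show "norm (block_modulus z (Suc k) - block_modulus z k) \<le> (8/5) * ((1/2) ^ k / 5)" using block_modulus_step[of k]
      unfolding real_norm_def by (simp only: mult.commute[of "8/5"])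
  qed
  then have "(\<lambda>n. \<Sum>k<n. block_modulus z (Suc k) - block_modulus z k) \<longlonglongrightarrow> (\<Sum>k. block_modulus z (Suc k) - block_modulus z k)" by (rule summable_LIMSEQ)
  then have "(\<lambda>n. block_modulus z n - block_modulus z 0) \<longlonglongrightarrow> (\<Sum>k. block_modulus z (Suc k) - block_modulus z k)" by (simp only: sum_lessThan_telescope)
  then have "(\<lambda>n. block_modulus z n - block_modulus z 0 + block_modulus z 0) \<longlonglongrightarrow> (\<Sum>k. block_modulus z (Suc k) - block_modulus z k) + block_modulus z 0" by (intro tendsto_intros)
  then show ?thesis by (auto simp: convergent_def)
qed

text \<open>Each block turns the phase by \<open>phase_turns\<close>, so \<open>u_moves\<close>
  gives a displacement of at least half the modulus at its start, and that modulus is at least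
  2/5.\<close>

lemma rev_op_oscillates:
  "\<exists>m n. block_start k \<le> m \<and> block_start k \<le> n \<and> 1/5 \<le> norm (poly (rev_op \<alpha> n) z - poly (rev_op \<alpha> m) z)"
proof -
  interpret chirp "block_eps k" "block_N k" "z * cis (pi / real ((block_N k)\<^sup>2))"
    "\<lambda>n. block_coeff k n * z ^ Suc (block_start k + n)" "\<lambda>n. poly (rev_op \<alpha> (block_start k + n)) z"
    by (rule chirp_block[OF z \<alpha>])
  obtain m n where "m \<le> n" "n \<le> 2 * (block_N k)\<^sup>2" "pi / 3 \<le> phase n - phase m" "phase n - phase m \<le> pi"
    using phase_turns[OF block_N_def block_q] by blast
  then have "norm (poly (rev_op \<alpha> (block_start k + 0)) z) / 2
     \<le> norm (poly (rev_op \<alpha> (block_start k + n)) z - poly (rev_op \<alpha> (block_start k + m)) z)"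
    by (rule u_moves)
  moreover have "2/5 \<le> norm (poly (rev_op \<alpha> (block_start k + 0)) z)" using block_modulus_bounds(1)[of k] by (simp add: block_modulus_def)
  ultimately show ?thesis
    by (intro exI[of _ "block_start k + m"] exI[of _ "block_start k + n"]) auto
qed

lemma not_convergent_rev_op: "\<not> convergent (\<lambda>n. poly (rev_op \<alpha> n) z)"
proof
  assume "convergent (\<lambda>n. poly (rev_op \<alpha> n) z)"
  then have "Cauchy (\<lambda>n. poly (rev_op \<alpha> n) z)" by (rule convergent_Cauchy)
  then obtain M where M: "\<And>m n. M \<le> m \<Longrightarrow> M \<le> n \<Longrightarrow> dist (poly (rev_op \<alpha> m) z) (poly (rev_op \<alpha> n) z) < 1/5"
    using metric_CauchyD[of _ "1/5"] by (metis zero_less_divide_1_iff zero_less_numeral)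
  obtain k where "M \<le> block_start k"
    using filterlim_block_start unfolding filterlim_at_top eventually_sequentially by blast
  moreover obtain m n where "block_start k \<le> m" "block_start k \<le> n"
    "1/5 \<le> norm (poly (rev_op \<alpha> n) z - poly (rev_op \<alpha> m) z)" using rev_op_oscillates by blast
  ultimately show False using M[of n m] by (simp add: dist_norm)
qed

end

section \<open>The limiting weight\<close>

text \<open>The lower bound is read off from the total mass: 1/\<open>monic_norm2\<close> at a block
  start is the integral of 1/|\<open>rev_op\<close>|^2, at most (5/2)^2. Monotonicity extends it to
  all n.\<close>

lemma monic_norm2_bounds: "4/25 \<le> monic_norm2 \<alpha> n" "monic_norm2 \<alpha> n \<le> 1"
proof -
  have pos: "0 < monic_norm2 \<alpha> n" for n using monic_norm2_pos[of \<alpha>] \<alpha>_less_1 by simp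
  have dec: "decseq (monic_norm2 \<alpha>)" using decseq_monic_norm2[of \<alpha>] \<alpha>_less_1 by simp
  show "monic_norm2 \<alpha> n \<le> 1" using decseqD[OF dec, of 0 n] by (simp add: monic_norm2_def)
  obtain k where k: "n \<le> block_start k"
    using filterlim_block_start unfolding filterlim_at_top eventually_sequentially by blast
  let ?f = "\<lambda>z. 1 / complex_of_real ((norm (poly (rev_op \<alpha> (block_start k)) z))\<^sup>2)"
  have "(\<integral>z. ?f z \<partial>circle_m) = of_real (1 / monic_norm2 \<alpha> (block_start k))"
    using bernstein_szego[of \<alpha> 0 "block_start k" 0] \<alpha>_less_1 by (simp add: monic_norm2_def)
  then have "1 / monic_norm2 \<alpha> (block_start k) = norm (\<integral>z. ?f z \<partial>circle_m)"
    using pos[of "block_start k"] by (simp add: norm_divide)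
  also have "\<dots> \<le> (\<integral>z. norm (?f z) \<partial>circle_m)" by (rule integral_norm_bound)
  also have "\<dots> \<le> (\<integral>z. 25/4 \<partial>circle_m)"
  proof (rule integral_mono_AE)
    show "integrable circle_m (\<lambda>z. norm (?f z))"
      using integrable_bernstein_szego[of \<alpha> "\<lambda>_. 1" "block_start k"] \<alpha>_less_1 by (intro integrable_norm) simp
    show "AE z in circle_m. norm (?f z) \<le> 25/4"
      using AE_circle_m
    proof eventually_elim
      case (elim z)
      have "(2/5)\<^sup>2 \<le> (block_modulus z k)\<^sup>2" using block_modulus_bounds(1)[OF elim, of k] by (intro power_mono) auto
      then have "1 / (block_modulus z k)\<^sup>2 \<le> 1 / (2/5)\<^sup>2" 
        using block_modulus_bounds(1)[OF elim, of k] by (intro divide_left_mono) (auto intro!: mult_pos_pos)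
      then show ?case by (simp add: block_modulus_def norm_divide norm_mult power2_eq_square)
    qed
  qed simp
  also have "\<dots> = 25/4" using circle_m.prob_space by simp
  finally have "4/25 \<le> monic_norm2 \<alpha> (block_start k)"
    using pos[of "block_start k"] by (simp add: field_simps)
  also have "\<dots> \<le> monic_norm2 \<alpha> n" by (rule decseqD[OF dec k])
  finally show "4/25 \<le> monic_norm2 \<alpha> n" .
qed

lemma convergent_monic_norm2: "convergent (monic_norm2 \<alpha>)"
proof -
  have "decseq (monic_norm2 \<alpha>)" using decseq_monic_norm2[of \<alpha>] \<alpha>_less_1 by simp
  then obtain L where "monic_norm2 \<alpha> \<longlonglongrightarrow> L"
    using decseq_convergent[of "monic_norm2 \<alpha>" "4/25"] monic_norm2_bounds(1) by blast
  then show ?thesis by (rule convergentI)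
qed

definition weight_approx :: "nat \<Rightarrow> complex \<Rightarrow> real" where
  "weight_approx k z = monic_norm2 \<alpha> (block_start k) / (norm (poly (rev_op \<alpha> (block_start k)) z))\<^sup>2"

text \<open>The value 1 off the circle makes the lower bound 1/16 hold everywhere, as
  \<open>szego_limit\<close> asks.\<close>

definition weight :: "complex \<Rightarrow> real" where
  "weight z = (if norm z = 1 then lim (\<lambda>k. weight_approx k z) else 1)"

lemma weight_approx_bounds:
  assumes "norm z = 1"
  shows "1/16 \<le> weight_approx k z" "weight_approx k z \<le> 25/4"
proof -
  let ?a = "norm (poly (rev_op \<alpha> (block_start k)) z)"
  have a: "2/5 \<le> ?a" "?a \<le> 8/5" using block_modulus_bounds[OF assms, of k] by (auto simp: block_modulus_def)
  then have "(2/5)\<^sup>2 \<le> ?a\<^sup>2" "?a\<^sup>2 \<le> (8/5)\<^sup>2" by (intro power_mono; simp)+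
  then have sq: "4/25 \<le> ?a\<^sup>2" "?a\<^sup>2 \<le> 64/25" by (auto simp: power2_eq_square)
  have p: "4/25 \<le> monic_norm2 \<alpha> (block_start k)" "monic_norm2 \<alpha> (block_start k) \<le> 1"
    using monic_norm2_bounds by auto
  have "(4/25) / (64/25) \<le> weight_approx k z"
    unfolding weight_approx_def using p sq by (intro frac_le) auto
  then show "1/16 \<le> weight_approx k z" by simp
  have "weight_approx k z \<le> 1 / (4/25)"
    unfolding weight_approx_def using p sq by (intro frac_le) auto
  then show "weight_approx k z \<le> 25/4" by simp
qed

lemma weight_lim:
  assumes "norm z = 1"
  shows "(\<lambda>k. weight_approx k z) \<longlonglongrightarrow> weight z"
proof -
  obtain a where a: "(\<lambda>k. norm (poly (rev_op \<alpha> (block_start k)) z)) \<longlonglongrightarrow> a"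
    using convergent_block_modulus[OF assms] unfolding convergent_def block_modulus_def by blast
  have "2/5 \<le> a"
    by (rule LIMSEQ_le_const[OF a]) (use block_modulus_bounds(1)[OF assms] in \<open>auto simp: block_modulus_def\<close>)
  then have a0: "a \<noteq> 0" by auto
  obtain p where "monic_norm2 \<alpha> \<longlonglongrightarrow> p" using convergent_monic_norm2 by (auto simp: convergent_def)
  then have "(\<lambda>k. monic_norm2 \<alpha> (block_start k)) \<longlonglongrightarrow> p"
    by (rule filterlim_compose[OF _ filterlim_block_start])
  then have "(\<lambda>k. weight_approx k z) \<longlonglongrightarrow> p / a\<^sup>2"
    unfolding weight_approx_def using a0 by (intro tendsto_intros a) auto
  then show ?thesis using assms by (simp add: weight_def limI)
qed

sublocale szego_limit \<alpha> block_start weight "1/16" "25/4"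
proof
  have [measurable]: "weight_approx k \<in> borel_measurable borel" for k
    unfolding weight_approx_def by measurable
  show "weight \<in> borel_measurable borel"
    unfolding weight_def by measurable
  show "1/16 \<le> weight z" for z
  proof (cases "norm z = 1")
    case True
    then show ?thesis using weight_approx_bounds(1) by (intro LIMSEQ_le_const[OF weight_lim]) auto
  qed (simp add: weight_def)
qed (use \<alpha>_less_1 filterlim_block_start weight_lim weight_approx_bounds in \<open>auto simp: weight_approx_def\<close>)

text \<open>The normalising factors converge, so multiplying them away would carry convergence over
  to \<open>rev_op\<close>.\<close>

lemma not_convergent_pstar:
  assumes z: "norm z = 1"
  shows "\<not> convergent (\<lambda>n. pstar (ONP \<sigma> n) z)"
proof
  assume "convergent (\<lambda>n. pstar (ONP \<sigma> n) z)"
  then obtain l where l: "(\<lambda>n. of_real (1 / sqrt (monic_norm2 \<alpha> n)) * poly (rev_op \<alpha> n) z) \<longlonglongrightarrow> l"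
    by (auto simp: convergent_def pstar_ONP[OF z])
  obtain p where p: "monic_norm2 \<alpha> \<longlonglongrightarrow> p" using convergent_monic_norm2 by (auto simp: convergent_def)
  have "(\<lambda>n. complex_of_real (sqrt (monic_norm2 \<alpha> n)) * (of_real (1 / sqrt (monic_norm2 \<alpha> n)) * poly (rev_op \<alpha> n) z))
      \<longlonglongrightarrow> of_real (sqrt p) * l"
    by (intro tendsto_intros p l)
  moreover have "complex_of_real (sqrt (monic_norm2 \<alpha> n)) * (of_real (1 / sqrt (monic_norm2 \<alpha> n)) * poly (rev_op \<alpha> n) z)
      = poly (rev_op \<alpha> n) z" for n
    using monic_norm2_bounds(1)[of n] by simp
  ultimately have "convergent (\<lambda>n. poly (rev_op \<alpha> n) z)" by (auto simp: convergent_def)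
  then show False using not_convergent_rev_op[OF z] by blast
qed

end

theorem theorem1p2:
  shows "\<exists>\<sigma>. prob_on_circle \<sigma> \<and> infinite (msupport \<sigma>) \<and> szego_class \<sigma> \<and>
           (\<forall>z \<in> circle. \<not> convergent (\<lambda>n. pstar (ONP \<sigma> n) z))"
proof -
  have len: "0 < 2 * (block_N k)\<^sup>2" for k using block_N_pos[of k] by simp
  obtain \<alpha> where \<alpha>: "\<And>k n. n < 2 * (block_N k)\<^sup>2 \<Longrightarrow> \<alpha> (block_start k + n) = block_coeff k n"
    and cover: "\<And>m. \<exists>k n. n < 2 * (block_N k)\<^sup>2 \<and> m = block_start k + n"
    using concatenation_of_blocks[OF len block_start_def, where f = block_coeff] by blast
  interpret concatenated_chirps \<alpha>
  proof
    show "norm (\<alpha> n) < 1" for n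
      using cover[of n] \<alpha> norm_block_coeff by auto
  qed (rule \<alpha>)
  show ?thesis
    using prob_on_circle_\<sigma> infinite_msupport_\<sigma> szego_class_\<sigma> not_convergent_pstar
    by (intro exI[of _ \<sigma>]) auto
qed

end
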